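(* Let $d\ge 2$ be a natural number (the spacetime dimension), and let $\mathsf{SRDyn}$ and $\exists\mathsf{FTLIp}$ be, respectively, the first-order axiom system and the first-order sentence (in the two-sorted language parameterized by $d$) defined in the context. Then $\exists\mathsf{FTLIp}$ is independent of $\mathsf{SRDyn}$, that is, $$\mathsf{SRDyn}\not\models \exists\mathsf{FTLIp}\qquad\text{and}\qquad \mathsf{SRDyn}\not\models\neg\,\exists\mathsf{FTLIp};$$ equivalently, both $\exists\mathsf{FTLIp}$ and $\neg\,\exists\mathsf{FTLIp}$ are consistent with $\mathsf{SRDyn}$ (there is a model of $\mathsf{SRDyn}$ in which $\exists\mathsf{FTLIp}$ is valid, and there is a model of $\mathsf{SRDyn}$ in which $\neg\,\exists\mathsf{FTLIp}$ is valid).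
   Context: **Language.** Fix a natural number $d\ge 2$. We use two-sorted first-order logic with equality, with sorts $B$ (bodies) and $Q$ (quantities), unary relation symbols $\mathsf{IOb}$ (inertial observers) and $\mathsf{Ph}$ (light signals) of sort $B$, binary function symbols $+,\cdot$ and a binary relation symbol $<$ of sort $Q$, a $(d+2)$-ary relation symbol $\mathsf{W}$ (first two arguments of sort $B$, the remaining $d$ of sort $Q$; $\mathsf{W}(k,b,\bar x)$ reads "$k$ coordinatizes $b$ at $\bar x$"), and a ternary relation symbol $\mathsf{M}$ (first two arguments of sort $B$, third of sort $Q$; $\mathsf{M}(k,b,q)$ reads "the relativistic mass of $b$ is $q$ according to $k$"). A model is $\mathfrak M=\langle B,Q;\mathsf{IOb},\mathsf{Ph},+,\cdot,<,\mathsf W,\mathsf M\rangle$ with $B,Q$ nonempty. For a set of formulas $\Sigma$ and formula $\varphi$, $\Sigma\models\varphi$ means $\varphi$ is valid in every model of $\Sigma$. In all axioms free variables are universally quantified. For $\bar x\in Q^n$, $x_i$ is its $i$-th component; for $\bar x\in Q^d$, $x_1$ is the time component. The axiom $\mathsf{AxEField}$ below is assumed in all definitions, so $0,1,-,/,\sqrt{\ }$ and the vector space structure of $Q^n$ are available. Convention: an atomic formula containing an undefined term (such as an undefined velocity, speed or mass) is false. **Definitions.** - $\mathsf{time}(\bar x,\bar y):=|x_1-y_1|$ and $\mathsf{space}(\bar x,\bar y):=\sqrt{(x_2-y_2)^2+\dots+(x_d-y_d)^2}$ for $\bar x,\bar y\in Q^d$. - $\mathsf{ev}_k(\bar x)=\mathsf{ev}_h(\bar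 y)$ abbreviates $\forall b\,[\mathsf W(k,b,\bar x)\leftrightarrow \mathsf W(h,b,\bar y)]$. - $\mathsf{FTL}(k,b)$: $\mathsf{IOb}(k)\wedge\exists \bar x\bar y\,[\mathsf W(k,b,\bar x)\wedge \mathsf W(k,b,\bar y)\wedge \mathsf{time}(\bar x,\bar y)<\mathsf{space}(\bar x,\bar y)]$. - A body $b$ is *inertial* if for every inertial observer $k$ the world-line $\{\bar x:\mathsf W(k,b,\bar x)\}$ is a subset of a straight line of $Q^d$ with at least two elements. - For an inertial body $b$ and inertial observer $k$: if there are $\bar x,\bar y$ with $\mathsf W(k,b,\bar x)$, $\mathsf W(k,b,\bar y)$, $x_1\ne y_1$, then the velocity is $\mathbf v_k(b):=\langle x_2-y_2,\dots,x_d-y_d\rangle/(x_1-y_1)$ and the speed is $v_k(b):=\mathsf{space}(\bar x,\bar y)/\mathsf{time}(\bar x,\bar y)$ (independent of the choice); otherwise both are undefined. $v_k(b)<\infty$ ("the speed is finite") means that $v_k(b)$ is defined. - $\mathsf m_k(b):=q$ if $\mathsf M(k,b,q)$ holds and $q$ is the only such element of $Q$; otherwise $\mathsf m_k(b)$ is undefined. - $\mathsf{Ip}(b)$ ("$b$ is an inertial particle"): $b$ is an inertial body and $\mathsf m_k(b)$ is defined for every inertial observer $k$. - $\mathsf{in}_k(b,\bar x)$: $\mathsf{Ip}(b)\wedge \mathsf W(k,b,\bar x)\wedge\forall\bar y\,(\mathsf W(k,b,\bar y)\to[\bar y=\bar x\vee y_1<x_1])$. $\mathsf{out}_k(b,\bar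 x)$: the same with $x_1<y_1$ in place of $y_1<x_1$. - $\mathsf{coll}_k(b_1\dots b_n)$ (possible collision): there is $\bar x\in Q^d$ such that for every $i$, $\mathsf{in}_k(b_i,\bar x)$ or $\mathsf{out}_k(b_i,\bar x)$, and $$\sum_{\{i:\mathsf{in}_k(b_i,\bar x)\}}\mathsf m_k(b_i)=\sum_{\{i:\mathsf{out}_k(b_i,\bar x)\}}\mathsf m_k(b_i),\qquad \sum_{\{i:\mathsf{in}_k(b_i,\bar x)\}}\mathsf m_k(b_i)\mathbf v_k(b_i)=\sum_{\{i:\mathsf{out}_k(b_i,\bar x)\}}\mathsf m_k(b_i)\mathbf v_k(b_i).$$ - $\bar x\text{-}\mathsf{inecoll}_k(ab)$: $\exists c\,[\mathsf{coll}_k(abc)\wedge \mathsf{in}_k(a,\bar x)\wedge\mathsf{in}_k(b,\bar x)\wedge\mathsf{out}_k(c,\bar x)]$. **Axioms of kinematics.** - $\mathsf{SPR}^+$ (schema): for every formula $\varphi$ of the language with at most one free variable of sort $B$ (and any free variables $\bar x$ of sort $Q$): $\mathsf{IOb}(k)\wedge\mathsf{IOb}(h)\to[\varphi(k,\bar x)\leftrightarrow\varphi(h,\bar x)]$. - $\mathsf{AxLight}$: $\exists k\,c\,\big[\mathsf{IOb}(k)\wedge 0<c\wedge\forall\bar x\bar y\,\big(\exists p[\mathsf{Ph}(p)\wedge\mathsf W(k,p,\bar x)\wedge\mathsf W(k,p,\bar y)]\leftrightarrow\mathsf{space}(\bar x,\bar y)=c\cdot\mathsf{time}(\bar x,\bar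 y)\big)\big]$. - $\mathsf{AxEField}$: $\langle Q,+,\cdot,<\rangle$ is a Euclidean field, i.e. a linearly ordered field in which every positive element has a square root. - $\mathsf{AxEv}$: $\mathsf{IOb}(k)\wedge\mathsf{IOb}(h)\to\exists\bar y\,\forall b\,[\mathsf W(k,b,\bar x)\leftrightarrow\mathsf W(h,b,\bar y)]$. - $\mathsf{AxSelf}$: $\mathsf{IOb}(k)\to\forall\bar x\,[\mathsf W(k,k,\bar x)\leftrightarrow x_2=\dots=x_d=0]$. - $\mathsf{AxSymD}$: $\mathsf{IOb}(k)\wedge\mathsf{IOb}(h)\wedge x_1=y_1\wedge x_1'=y_1'\wedge\mathsf{ev}_k(\bar x)=\mathsf{ev}_h(\bar x')\wedge\mathsf{ev}_k(\bar y)=\mathsf{ev}_h(\bar y')\to\mathsf{space}(\bar x,\bar y)=\mathsf{space}(\bar x',\bar y')$; and $\mathsf{IOb}(k)\to\exists p\,[\mathsf{Ph}(p)\wedge\mathsf W(k,p,0,\dots,0)\wedge\mathsf W(k,p,1,1,0,\dots,0)]$. **Axioms of dynamics.** - $\mathsf{Coll}$ (schema): for every natural number $n$, $\mathsf{AxColl}_n$: $\mathsf{IOb}(k)\wedge\mathsf{IOb}(h)\wedge\bigwedge_{i=1}^n v_h(b_i)<\infty\wedge\mathsf{coll}_k(b_1\dots b_n)\to\mathsf{coll}_h(b_1\dots b_n)$. - $\mathsf{Ax\forall inecoll}$: $\mathsf{IOb}(k)\wedge\mathsf{Ip}(a)\wedge\mathsf{Ip}(b)\wedge v_k(a)<\infty\wedge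 v_k(b)<\infty\wedge\mathsf m_k(a)+\mathsf m_k(b)\neq0\to\exists a'b'\,[\bar x\text{-}\mathsf{inecoll}_k(a'b')\wedge\mathsf m_k(a')=\mathsf m_k(a)\wedge\mathsf m_k(b')=\mathsf m_k(b)\wedge\mathbf v_k(a')=\mathbf v_k(a)\wedge\mathbf v_k(b')=\mathbf v_k(b)]$. - $\mathsf{AxSpd}$: $\mathsf{IOb}(k)\wedge\mathsf{IOb}(h)\wedge\mathsf{Ip}(b)\wedge v_k(b)=v_h(b)<1\to\mathsf m_k(b)=\mathsf m_h(b)$. - $\mathsf{AxMass}$: $\mathsf{IOb}(k)\wedge\mathsf{IOb}(h)\wedge\mathsf{Ip}(a)\wedge\mathsf{Ip}(b)\wedge\mathsf m_k(a)=\mathsf m_k(b)\wedge\mathbf v_k(a)=\mathbf v_k(b)\to\mathsf m_h(a)=\mathsf m_h(b)$. - $\mathsf{AxThEx}^+$: $\big(\mathsf{IOb}(k)\wedge\mathsf{space}(\bar x,\bar y)<\mathsf{time}(\bar x,\bar y)\to\exists h\,[\mathsf{IOb}(h)\wedge\mathsf W(k,h,\bar x)\wedge\mathsf W(k,h,\bar y)]\big)$ and $\big(\mathsf{IOb}(k)\wedge\mathsf{space}(\bar x,\bar y)\le\mathsf{time}(\bar x,\bar y)\wedge0<q\to\exists b\,[\mathsf{Ip}(b)\wedge\mathsf W(k,b,\bar x)\wedge\mathsf W(k,b,\bar y)\wedge\mathsf m_k(b)=q]\big)$. - $\mathsf{Ax\forall Coll}$: $\mathsf{IOb}(k)\wedge\mathsf{Ip}(a)\wedge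 v_k(a)<\infty\to\big(\exists b\,[\mathsf{out}_k(b,\bar x)\wedge\mathsf m_k(b)=\mathsf m_k(a)\wedge\mathbf v_k(b)=\mathbf v_k(a)]\wedge\exists b\,[\mathsf{in}_k(b,\bar x)\wedge\mathsf m_k(b)=\mathsf m_k(a)\wedge\mathbf v_k(b)=\mathbf v_k(a)]\big)$. **Axiom systems and the sentence.** $\mathsf{SR}:=\mathsf{SPR}^+\cup\{\mathsf{AxLight},\mathsf{AxEField},\mathsf{AxEv},\mathsf{AxSelf},\mathsf{AxSymD}\}$ and $\mathsf{SRDyn}:=\mathsf{SR}\cup\mathsf{Coll}\cup\{\mathsf{Ax\forall inecoll},\mathsf{AxSpd},\mathsf{AxMass},\mathsf{AxThEx}^+,\mathsf{Ax\forall Coll}\}$. $\exists\mathsf{FTLIp}$ is the sentence $\exists k\,b\,[\mathsf{Ip}(b)\wedge\mathsf{FTL}(k,b)\wedge\mathsf m_k(b)>0]$ (there is a faster than light inertial particle of positive relativistic mass). A sentence $\varphi$ is independent of $\Sigma$ if neither $\varphi$ nor $\neg\varphi$ is logically implied by $\Sigma$. *)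

theory Defs
  imports Complex_Main "HOL-Algebra.Ring"
begin

text \<open>Structures have explicit carriers \<open>bodies\<close> and \<open>quants\<close> for the two
  sorts.  A point of $Q^d$ is a list of length \<open>d\<close> over \<open>quants\<close>; indices are shifted by one, so
  \<open>x ! 0\<close> is the time component $x_1$ and \<open>x ! i\<close> with \<open>0 < i < d\<close> are the spatial components
  $x_2, \dots, x_d$.\<close>

record ('b, 'q) model =
  bodies :: "'b set"
  quants :: "'q set"
  IOb :: "'b set"
  Ph :: "'b set"
  plusQ :: "'q \<Rightarrow> 'q \<Rightarrow> 'q"
  timesQ :: "'q \<Rightarrow> 'q \<Rightarrow> 'q"
  lessQ :: "'q \<Rightarrow> 'q \<Rightarrow> bool"
  Wrel :: "'b \<Rightarrow> 'b \<Rightarrow> 'q list \<Rightarrow> bool"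
  Mrel :: "'b \<Rightarrow> 'b \<Rightarrow> 'q \<Rightarrow> bool"

definition points :: "nat \<Rightarrow> ('b, 'q) model \<Rightarrow> 'q list set" where
  "points d M = {x. length x = d \<and> set x \<subseteq> quants M}"

definition is_model :: "nat \<Rightarrow> ('b, 'q) model \<Rightarrow> bool" where
  "is_model d M \<longleftrightarrow>
     bodies M \<noteq> {} \<and> quants M \<noteq> {} \<and>
     IOb M \<subseteq> bodies M \<and> Ph M \<subseteq> bodies M \<and>
     (\<forall>p\<in>quants M. \<forall>q\<in>quants M. plusQ M p q \<in> quants M \<and> timesQ M p q \<in> quants M) \<and>
     (\<forall>p q. lessQ M p q \<longrightarrow> p \<in> quants M \<and> q \<in> quants M) \<and>
     (\<forall>k b x. Wrel M k b x \<longrightarrow> k \<in> bodies M \<and> b \<in> bodies M \<and> x \<in> points d M) \<and>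
     (\<forall>k b q. Mrel M k b q \<longrightarrow> k \<in> bodies M \<and> b \<in> bodies M \<and> q \<in> quants M)"

subsection \<open>Sentences, consequence, independence\<close>

text \<open>Sentences are rendered by their truth conditions, i.e. as properties of models; formulas are
  embedded syntactically only where the axiom schema of special relativity quantifies over them.
  Consequence refers to all models whose carriers are subsets of the two type arguments.  The
  language is countable, so by the Loewenheim-Skolem theorems any two infinite types yield the
  consequence relation over all models.\<close>

type_synonym ('b, 'q) sentence = "('b, 'q) model \<Rightarrow> bool"

definition entails :: "nat \<Rightarrow> ('b, 'q) sentence set \<Rightarrow> ('b, 'q) sentence \<Rightarrow> bool" where
  "entails d \<Sigma> \<phi> \<longleftrightarrow> (\<forall>M. is_model d M \<and> (\<forall>\<psi>\<in>\<Sigma>. \<psi> M) \<longrightarrow> \<phi> M)"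

definition NotS :: "('b, 'q) sentence \<Rightarrow> ('b, 'q) sentence" where
  "NotS \<phi> = (\<lambda>M. \<not> \<phi> M)"

definition independent_of :: "nat \<Rightarrow> ('b, 'q) sentence \<Rightarrow> ('b, 'q) sentence set \<Rightarrow> bool" where
  "independent_of d \<phi> \<Sigma> \<longleftrightarrow> \<not> entails d \<Sigma> \<phi> \<and> \<not> entails d \<Sigma> (NotS \<phi>)"

subsection \<open>First-order formulas\<close>

text \<open>Variables of each sort are named by natural numbers, the two name spaces being disjoint.\<close>

datatype qterm = QVar nat | Plus qterm qterm | Times qterm qterm

datatype form =
    EqB nat nat
  | EqQ qterm qterm
  | IObF nat
  | PhF nat
  | LessF qterm qterm
  | WF nat nat "qterm list"
  | MF nat nat qterm
  | Neg form
  | Conj form form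
  | ExB nat form
  | ExQ nat form

fun well_formed :: "nat \<Rightarrow> form \<Rightarrow> bool" where
  "well_formed d (WF u v ts) \<longleftrightarrow> length ts = d"
| "well_formed d (Neg \<phi>) \<longleftrightarrow> well_formed d \<phi>"
| "well_formed d (Conj \<phi> \<psi>) \<longleftrightarrow> well_formed d \<phi> \<and> well_formed d \<psi>"
| "well_formed d (ExB u \<phi>) \<longleftrightarrow> well_formed d \<phi>"
| "well_formed d (ExQ u \<phi>) \<longleftrightarrow> well_formed d \<phi>"
| "well_formed d _ \<longleftrightarrow> True"

fun freeB :: "form \<Rightarrow> nat set" where
  "freeB (EqB u v) = {u, v}"
| "freeB (EqQ s t) = {}"
| "freeB (IObF u) = {u}"
| "freeB (PhF u) = {u}"
| "freeB (LessF s t) = {}"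
| "freeB (WF u v ts) = {u, v}"
| "freeB (MF u v t) = {u, v}"
| "freeB (Neg \<phi>) = freeB \<phi>"
| "freeB (Conj \<phi> \<psi>) = freeB \<phi> \<union> freeB \<psi>"
| "freeB (ExB u \<phi>) = freeB \<phi> - {u}"
| "freeB (ExQ u \<phi>) = freeB \<phi>"

fun qval :: "('b, 'q) model \<Rightarrow> (nat \<Rightarrow> 'q) \<Rightarrow> qterm \<Rightarrow> 'q" where
  "qval M f (QVar n) = f n"
| "qval M f (Plus s t) = plusQ M (qval M f s) (qval M f t)"
| "qval M f (Times s t) = timesQ M (qval M f s) (qval M f t)"

fun sat :: "('b, 'q) model \<Rightarrow> (nat \<Rightarrow> 'b) \<Rightarrow> (nat \<Rightarrow> 'q) \<Rightarrow> form \<Rightarrow> bool" where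
  "sat M e f (EqB u v) \<longleftrightarrow> e u = e v"
| "sat M e f (EqQ s t) \<longleftrightarrow> qval M f s = qval M f t"
| "sat M e f (IObF u) \<longleftrightarrow> e u \<in> IOb M"
| "sat M e f (PhF u) \<longleftrightarrow> e u \<in> Ph M"
| "sat M e f (LessF s t) \<longleftrightarrow> lessQ M (qval M f s) (qval M f t)"
| "sat M e f (WF u v ts) \<longleftrightarrow> Wrel M (e u) (e v) (map (qval M f) ts)"
| "sat M e f (MF u v t) \<longleftrightarrow> Mrel M (e u) (e v) (qval M f t)"
| "sat M e f (Neg \<phi>) \<longleftrightarrow> \<not> sat M e f \<phi>"
| "sat M e f (Conj \<phi> \<psi>) \<longleftrightarrow> sat M e f \<phi> \<and> sat M e f \<psi>"
| "sat M e f (ExB u \<phi>) \<longleftrightarrow> (\<exists>b\<in>bodies M. sat M (e(u := b)) f \<phi>)"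
| "sat M e f (ExQ u \<phi>) \<longleftrightarrow> (\<exists>q\<in>quants M. sat M e (f(u := q)) \<phi>)"

subsection \<open>The field of quantities\<close>

text \<open>The constants 0 and 1 are not in the language; under \<open>AxEField\<close> the descriptions below
  denote the neutral elements.\<close>

definition QR :: "('b, 'q) model \<Rightarrow> 'q ring" where
  "QR M = \<lparr>carrier = quants M, mult = timesQ M,
     one = (THE e. e \<in> quants M \<and> (\<forall>x\<in>quants M. timesQ M x e = x)),
     zero = (THE z. z \<in> quants M \<and> (\<forall>x\<in>quants M. plusQ M x z = x)),
     add = plusQ M\<rparr>"

definition AxEField :: "('b, 'q) sentence" where
  "AxEField M \<longleftrightarrow>
     field (QR M) \<and>
     (\<forall>x\<in>quants M. \<not> lessQ M x x) \<and>
     (\<forall>x\<in>quants M. \<forall>y\<in>quants M. \<forall>z\<in>quants M. lessQ M x y \<and> lessQ M y z \<longrightarrow> lessQ M x z) \<and>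
     (\<forall>x\<in>quants M. \<forall>y\<in>quants M. lessQ M x y \<or> x = y \<or> lessQ M y x) \<and>
     (\<forall>x\<in>quants M. \<forall>y\<in>quants M. \<forall>z\<in>quants M.
        lessQ M x y \<longrightarrow> lessQ M (plusQ M x z) (plusQ M y z)) \<and>
     (\<forall>x\<in>quants M. \<forall>y\<in>quants M.
        lessQ M \<zero>\<^bsub>QR M\<^esub> x \<and> lessQ M \<zero>\<^bsub>QR M\<^esub> y \<longrightarrow> lessQ M \<zero>\<^bsub>QR M\<^esub> (timesQ M x y)) \<and>
     (\<forall>x\<in>quants M. lessQ M \<zero>\<^bsub>QR M\<^esub> x \<longrightarrow> (\<exists>y\<in>quants M. timesQ M y y = x))"

definition leQ :: "('b, 'q) model \<Rightarrow> 'q \<Rightarrow> 'q \<Rightarrow> bool" where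
  "leQ M x y \<longleftrightarrow> lessQ M x y \<or> x = y"

definition absQ :: "('b, 'q) model \<Rightarrow> 'q \<Rightarrow> 'q" where
  "absQ M x = (if lessQ M x \<zero>\<^bsub>QR M\<^esub> then \<ominus>\<^bsub>QR M\<^esub> x else x)"

definition sqrtQ :: "('b, 'q) model \<Rightarrow> 'q \<Rightarrow> 'q" where
  "sqrtQ M x = (THE y. y \<in> quants M \<and> leQ M \<zero>\<^bsub>QR M\<^esub> y \<and> timesQ M y y = x)"

definition divQ :: "('b, 'q) model \<Rightarrow> 'q \<Rightarrow> 'q \<Rightarrow> 'q" where
  "divQ M x y = x \<otimes>\<^bsub>QR M\<^esub> inv\<^bsub>QR M\<^esub> y"

definition time_dist :: "('b, 'q) model \<Rightarrow> 'q list \<Rightarrow> 'q list \<Rightarrow> 'q" where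
  "time_dist M x y = absQ M (x ! 0 \<ominus>\<^bsub>QR M\<^esub> y ! 0)"

definition space_dist :: "nat \<Rightarrow> ('b, 'q) model \<Rightarrow> 'q list \<Rightarrow> 'q list \<Rightarrow> 'q" where
  "space_dist d M x y = sqrtQ M
     (\<Oplus>\<^bsub>QR M\<^esub>i\<in>{1..<d}. (x ! i \<ominus>\<^bsub>QR M\<^esub> y ! i) \<otimes>\<^bsub>QR M\<^esub> (x ! i \<ominus>\<^bsub>QR M\<^esub> y ! i))"

definition straight_line :: "nat \<Rightarrow> ('b, 'q) model \<Rightarrow> 'q list set \<Rightarrow> bool" where
  "straight_line d M L \<longleftrightarrow>
     (\<exists>p\<in>points d M. \<exists>v\<in>points d M. v \<noteq> replicate d \<zero>\<^bsub>QR M\<^esub> \<and>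
        L = {map (\<lambda>i. p ! i \<oplus>\<^bsub>QR M\<^esub> t \<otimes>\<^bsub>QR M\<^esub> v ! i) [0..<d] | t. t \<in> quants M})"

subsection \<open>Kinematical and dynamical notions\<close>

definition same_event :: "('b, 'q) model \<Rightarrow> 'b \<Rightarrow> 'q list \<Rightarrow> 'b \<Rightarrow> 'q list \<Rightarrow> bool" where
  "same_event M k x h y \<longleftrightarrow> (\<forall>b\<in>bodies M. Wrel M k b x \<longleftrightarrow> Wrel M h b y)"

definition FTL :: "nat \<Rightarrow> ('b, 'q) model \<Rightarrow> 'b \<Rightarrow> 'b \<Rightarrow> bool" where
  "FTL d M k b \<longleftrightarrow> k \<in> IOb M \<and>
     (\<exists>x\<in>points d M. \<exists>y\<in>points d M. Wrel M k b x \<and> Wrel M k b y \<and>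
        lessQ M (time_dist M x y) (space_dist d M x y))"

definition world_line :: "nat \<Rightarrow> ('b, 'q) model \<Rightarrow> 'b \<Rightarrow> 'b \<Rightarrow> 'q list set" where
  "world_line d M k b = {x \<in> points d M. Wrel M k b x}"

text \<open>It is the world-line, not the line containing it, that must have at least two elements.\<close>

definition inertial_body :: "nat \<Rightarrow> ('b, 'q) model \<Rightarrow> 'b \<Rightarrow> bool" where
  "inertial_body d M b \<longleftrightarrow>
     (\<forall>k\<in>IOb M. (\<exists>L. straight_line d M L \<and> world_line d M k b \<subseteq> L) \<and>
        (\<exists>x\<in>world_line d M k b. \<exists>y\<in>world_line d M k b. x \<noteq> y))"

text \<open>Partial terms have option values.  An atomic formula with an undefined term is false, whence
  the existential equality \<open>eqd\<close>.\<close>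

definition eqd :: "'a option \<Rightarrow> 'a option \<Rightarrow> bool" where
  "eqd s t \<longleftrightarrow> (\<exists>r. s = Some r \<and> t = Some r)"

definition has_velocity :: "nat \<Rightarrow> ('b, 'q) model \<Rightarrow> 'b \<Rightarrow> 'b \<Rightarrow> bool" where
  "has_velocity d M k b \<longleftrightarrow> k \<in> IOb M \<and> inertial_body d M b \<and>
     (\<exists>x\<in>world_line d M k b. \<exists>y\<in>world_line d M k b. x ! 0 \<noteq> y ! 0)"

definition velocity :: "nat \<Rightarrow> ('b, 'q) model \<Rightarrow> 'b \<Rightarrow> 'b \<Rightarrow> 'q list option" where
  "velocity d M k b =
     (if has_velocity d M k b
      then Some (THE v. \<exists>x\<in>world_line d M k b. \<exists>y\<in>world_line d M k b. x ! 0 \<noteq> y ! 0 \<and>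
        v = map (\<lambda>i. divQ M (x ! i \<ominus>\<^bsub>QR M\<^esub> y ! i) (x ! 0 \<ominus>\<^bsub>QR M\<^esub> y ! 0)) [1..<d])
      else None)"

definition speed :: "nat \<Rightarrow> ('b, 'q) model \<Rightarrow> 'b \<Rightarrow> 'b \<Rightarrow> 'q option" where
  "speed d M k b =
     (if has_velocity d M k b
      then Some (THE s. \<exists>x\<in>world_line d M k b. \<exists>y\<in>world_line d M k b. x ! 0 \<noteq> y ! 0 \<and>
        s = divQ M (space_dist d M x y) (time_dist M x y))
      else None)"

abbreviation finite_speed :: "nat \<Rightarrow> ('b, 'q) model \<Rightarrow> 'b \<Rightarrow> 'b \<Rightarrow> bool" where
  "finite_speed d M k b \<equiv> speed d M k b \<noteq> None"

definition mass :: "('b, 'q) model \<Rightarrow> 'b \<Rightarrow> 'b \<Rightarrow> 'q option" where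
  "mass M k b =
     (if \<exists>!q. q \<in> quants M \<and> Mrel M k b q
      then Some (THE q. q \<in> quants M \<and> Mrel M k b q) else None)"

definition Ip :: "nat \<Rightarrow> ('b, 'q) model \<Rightarrow> 'b \<Rightarrow> bool" where
  "Ip d M b \<longleftrightarrow> b \<in> bodies M \<and> inertial_body d M b \<and> (\<forall>k\<in>IOb M. mass M k b \<noteq> None)"

definition in_at :: "nat \<Rightarrow> ('b, 'q) model \<Rightarrow> 'b \<Rightarrow> 'b \<Rightarrow> 'q list \<Rightarrow> bool" where
  "in_at d M k b x \<longleftrightarrow> Ip d M b \<and> Wrel M k b x \<and>
     (\<forall>y\<in>points d M. Wrel M k b y \<longrightarrow> y = x \<or> lessQ M (y ! 0) (x ! 0))"

definition out_at :: "nat \<Rightarrow> ('b, 'q) model \<Rightarrow> 'b \<Rightarrow> 'b \<Rightarrow> 'q list \<Rightarrow> bool" where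
  "out_at d M k b x \<longleftrightarrow> Ip d M b \<and> Wrel M k b x \<and>
     (\<forall>y\<in>points d M. Wrel M k b y \<longrightarrow> y = x \<or> lessQ M (x ! 0) (y ! 0))"

text \<open>The functions \<open>m\<close> and \<open>v\<close> witness that all masses and velocities in the two balance
  equations are defined.  The sums range over indices, so repeated bodies count repeatedly.  The
  list of a velocity starts with the first spatial component.\<close>

definition coll :: "nat \<Rightarrow> ('b, 'q) model \<Rightarrow> 'b \<Rightarrow> 'b list \<Rightarrow> bool" where
  "coll d M k bs \<longleftrightarrow>
     (\<exists>x\<in>points d M.
        (\<forall>i<length bs. in_at d M k (bs ! i) x \<or> out_at d M k (bs ! i) x) \<and>
        (let I = {i. i < length bs \<and> in_at d M k (bs ! i) x};
             J = {i. i < length bs \<and> out_at d M k (bs ! i) x}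
         in \<exists>m v. (\<forall>i<length bs. mass M k (bs ! i) = Some (m i) \<and>
                     velocity d M k (bs ! i) = Some (v i)) \<and>
              (\<Oplus>\<^bsub>QR M\<^esub>i\<in>I. m i) = (\<Oplus>\<^bsub>QR M\<^esub>i\<in>J. m i) \<and>
              (\<forall>j<d - 1. (\<Oplus>\<^bsub>QR M\<^esub>i\<in>I. m i \<otimes>\<^bsub>QR M\<^esub> v i ! j) = (\<Oplus>\<^bsub>QR M\<^esub>i\<in>J. m i \<otimes>\<^bsub>QR M\<^esub> v i ! j))))"

definition inecoll :: "nat \<Rightarrow> ('b, 'q) model \<Rightarrow> 'q list \<Rightarrow> 'b \<Rightarrow> 'b \<Rightarrow> 'b \<Rightarrow> bool" where
  "inecoll d M x k a b \<longleftrightarrow>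
     (\<exists>c\<in>bodies M. coll d M k [a, b, c] \<and> in_at d M k a x \<and> in_at d M k b x \<and> out_at d M k c x)"

subsection \<open>Axioms of kinematics\<close>

text \<open>The formula \<open>\<phi>\<close> has no free body variable besides \<open>u\<close>.\<close>

definition SPRplus_inst :: "form \<Rightarrow> nat \<Rightarrow> ('b, 'q) sentence" where
  "SPRplus_inst \<phi> u M \<longleftrightarrow>
     (\<forall>k\<in>IOb M. \<forall>h\<in>IOb M. \<forall>e f. range e \<subseteq> bodies M \<and> range f \<subseteq> quants M \<longrightarrow>
        (sat M (e(u := k)) f \<phi> \<longleftrightarrow> sat M (e(u := h)) f \<phi>))"

definition SPRplus :: "nat \<Rightarrow> ('b, 'q) sentence set" where
  "SPRplus d = {SPRplus_inst \<phi> u | \<phi> u. well_formed d \<phi> \<and> freeB \<phi> \<subseteq> {u}}"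

definition AxLight :: "nat \<Rightarrow> ('b, 'q) sentence" where
  "AxLight d M \<longleftrightarrow>
     (\<exists>k\<in>IOb M. \<exists>c\<in>quants M. lessQ M \<zero>\<^bsub>QR M\<^esub> c \<and>
        (\<forall>x\<in>points d M. \<forall>y\<in>points d M.
           (\<exists>p\<in>Ph M. Wrel M k p x \<and> Wrel M k p y) \<longleftrightarrow>
           space_dist d M x y = c \<otimes>\<^bsub>QR M\<^esub> time_dist M x y))"

definition AxEv :: "nat \<Rightarrow> ('b, 'q) sentence" where
  "AxEv d M \<longleftrightarrow>
     (\<forall>k\<in>IOb M. \<forall>h\<in>IOb M. \<forall>x\<in>points d M. \<exists>y\<in>points d M. same_event M k x h y)"

definition AxSelf :: "nat \<Rightarrow> ('b, 'q) sentence" where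
  "AxSelf d M \<longleftrightarrow>
     (\<forall>k\<in>IOb M. \<forall>x\<in>points d M. Wrel M k k x \<longleftrightarrow> (\<forall>i\<in>{1..<d}. x ! i = \<zero>\<^bsub>QR M\<^esub>))"

definition AxSymD :: "nat \<Rightarrow> ('b, 'q) sentence" where
  "AxSymD d M \<longleftrightarrow>
     (\<forall>k\<in>IOb M. \<forall>h\<in>IOb M.
        \<forall>x\<in>points d M. \<forall>y\<in>points d M. \<forall>x'\<in>points d M. \<forall>y'\<in>points d M.
        x ! 0 = y ! 0 \<and> x' ! 0 = y' ! 0 \<and> same_event M k x h x' \<and> same_event M k y h y' \<longrightarrow>
        space_dist d M x y = space_dist d M x' y') \<and>
     (\<forall>k\<in>IOb M. \<exists>p\<in>Ph M. Wrel M k p (replicate d \<zero>\<^bsub>QR M\<^esub>) \<and>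
        Wrel M k p (\<one>\<^bsub>QR M\<^esub> # \<one>\<^bsub>QR M\<^esub> # replicate (d - 2) \<zero>\<^bsub>QR M\<^esub>))"

definition SR :: "nat \<Rightarrow> ('b, 'q) sentence set" where
  "SR d = SPRplus d \<union> {AxLight d, AxEField, AxEv d, AxSelf d, AxSymD d}"

subsection \<open>Axioms of dynamics\<close>

definition AxColl :: "nat \<Rightarrow> nat \<Rightarrow> ('b, 'q) sentence" where
  "AxColl d n M \<longleftrightarrow>
     (\<forall>k\<in>IOb M. \<forall>h\<in>IOb M. \<forall>bs. length bs = n \<and> set bs \<subseteq> bodies M \<and>
        (\<forall>i<n. finite_speed d M h (bs ! i)) \<and> coll d M k bs \<longrightarrow> coll d M h bs)"

definition Coll :: "nat \<Rightarrow> ('b, 'q) sentence set" where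
  "Coll d = range (AxColl d)"

definition AxAllInecoll :: "nat \<Rightarrow> ('b, 'q) sentence" where
  "AxAllInecoll d M \<longleftrightarrow>
     (\<forall>k\<in>IOb M. \<forall>a\<in>bodies M. \<forall>b\<in>bodies M. \<forall>x\<in>points d M.
        Ip d M a \<and> Ip d M b \<and> finite_speed d M k a \<and> finite_speed d M k b \<and>
        (\<exists>p q. mass M k a = Some p \<and> mass M k b = Some q \<and> p \<oplus>\<^bsub>QR M\<^esub> q \<noteq> \<zero>\<^bsub>QR M\<^esub>) \<longrightarrow>
        (\<exists>a'\<in>bodies M. \<exists>b'\<in>bodies M. inecoll d M x k a' b' \<and>
           eqd (mass M k a') (mass M k a) \<and> eqd (mass M k b') (mass M k b) \<and>
           eqd (velocity d M k a') (velocity d M k a) \<and>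
           eqd (velocity d M k b') (velocity d M k b)))"

definition AxSpd :: "nat \<Rightarrow> ('b, 'q) sentence" where
  "AxSpd d M \<longleftrightarrow>
     (\<forall>k\<in>IOb M. \<forall>h\<in>IOb M. \<forall>b\<in>bodies M. Ip d M b \<and>
        (\<exists>s. speed d M k b = Some s \<and> speed d M h b = Some s \<and> lessQ M s \<one>\<^bsub>QR M\<^esub>) \<longrightarrow>
        eqd (mass M k b) (mass M h b))"

definition AxMass :: "nat \<Rightarrow> ('b, 'q) sentence" where
  "AxMass d M \<longleftrightarrow>
     (\<forall>k\<in>IOb M. \<forall>h\<in>IOb M. \<forall>a\<in>bodies M. \<forall>b\<in>bodies M.
        Ip d M a \<and> Ip d M b \<and> eqd (mass M k a) (mass M k b) \<and>
        eqd (velocity d M k a) (velocity d M k b) \<longrightarrow>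
        eqd (mass M h a) (mass M h b))"

definition AxThExPlus :: "nat \<Rightarrow> ('b, 'q) sentence" where
  "AxThExPlus d M \<longleftrightarrow>
     (\<forall>k\<in>IOb M. \<forall>x\<in>points d M. \<forall>y\<in>points d M.
        lessQ M (space_dist d M x y) (time_dist M x y) \<longrightarrow>
        (\<exists>h\<in>IOb M. Wrel M k h x \<and> Wrel M k h y)) \<and>
     (\<forall>k\<in>IOb M. \<forall>x\<in>points d M. \<forall>y\<in>points d M. \<forall>q\<in>quants M.
        leQ M (space_dist d M x y) (time_dist M x y) \<and> lessQ M \<zero>\<^bsub>QR M\<^esub> q \<longrightarrow>
        (\<exists>b\<in>bodies M. Ip d M b \<and> Wrel M k b x \<and> Wrel M k b y \<and> mass M k b = Some q))"

definition AxAllColl :: "nat \<Rightarrow> ('b, 'q) sentence" where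
  "AxAllColl d M \<longleftrightarrow>
     (\<forall>k\<in>IOb M. \<forall>a\<in>bodies M. \<forall>x\<in>points d M. Ip d M a \<and> finite_speed d M k a \<longrightarrow>
        (\<exists>b\<in>bodies M. out_at d M k b x \<and> eqd (mass M k b) (mass M k a) \<and>
           eqd (velocity d M k b) (velocity d M k a)) \<and>
        (\<exists>b\<in>bodies M. in_at d M k b x \<and> eqd (mass M k b) (mass M k a) \<and>
           eqd (velocity d M k b) (velocity d M k a)))"

definition SRDyn :: "nat \<Rightarrow> ('b, 'q) sentence set" where
  "SRDyn d = SR d \<union> Coll d \<union>
     {AxAllInecoll d, AxSpd d, AxMass d, AxThExPlus d, AxAllColl d}"

definition ExFTLIp :: "nat \<Rightarrow> ('b, 'q) sentence" where
  "ExFTLIp d M \<longleftrightarrow>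
     (\<exists>k\<in>bodies M. \<exists>b\<in>bodies M. Ip d M b \<and> FTL d M k b \<and>
        (\<exists>q. mass M k b = Some q \<and> lessQ M \<zero>\<^bsub>QR M\<^esub> q))"

end

theory Submission
  imports Defs "HOL-Analysis.L2_Norm"
begin

text \<open>Over the reals, let the inertial observers be the Poincare transformations of Minkowski
  space, and let the other bodies be the half-lines \<open>{x + t p | t \<ge> 0}\<close> with \<open>p \<noteq> 0\<close>, where the
  mass of such a body for an observer is the absolute value of the time component of \<open>p\<close> in the
  coordinates of that observer.  The sign of this component decides whether the body is incoming or
  outgoing, so bodies form a possible collision exactly if they issue from one point and their
  vectors \<open>p\<close> add up to \<open>0\<close>.  This condition does not depend on the observer, even if some \<open>p\<close> are
  spacelike and their time direction is observer-dependent.  Allowing all \<open>p\<close>, or only those that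
  are not spacelike, gives the two models.  The Poincare group acts on each model by automorphisms
  fixing the quantities and is transitive on observers, which yields the strong principle of
  relativity.\<close>

section \<open>Automorphisms and the principle of relativity\<close>

text \<open>Half-lines are used because \<open>in_at\<close> and \<open>out_at\<close> ask for a
  last or a first event, which a full line lacks. Observers may also reverse time, so even a
  timelike \<open>p\<close> can change the sign of its time component; this is harmless, since a
  sign change only moves a term across the balance equations. If the time component of a spacelike
  \<open>p\<close> vanishes, the mass is 0 and the body remains an inertial particle, but its speed
  is undefined: this is the case that the finiteness hypothesis of the collision axiom sets aside.
  For causal vectors this is convexity of the future cone; if all vectors are allowed, the sum only
  has to be nonzero. Bodies must finally be coded as reals, although the type of maps on vectors is
  larger than the continuum. This succeeds because an affine map is determined by finitely many
  values.\<close>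

lemma sat_cong_freeB:
  assumes "\<forall>v\<in>freeB \<phi>. e v = e' v"
  shows "sat M e f \<phi> \<longleftrightarrow> sat M e' f \<phi>"
  using assms
proof (induction \<phi> arbitrary: e e' f)
  case (ExB u \<phi>)
  have "sat M (e(u := b)) f \<phi> \<longleftrightarrow> sat M (e'(u := b)) f \<phi>" for b
    by (rule ExB.IH) (use ExB.prems in auto)
  then show ?case by simp
next
  case (Conj \<phi> \<psi>)
  show ?case
    using Conj.IH(1)[of e e' f] Conj.IH(2)[of e e' f] Conj.prems by (simp add: ball_Un)
next
  case (ExQ u \<phi>)
  then have "sat M e (f(u := q)) \<phi> \<longleftrightarrow> sat M e' (f(u := q)) \<phi>" for q
    by (metis freeB.simps(11))
  then show ?case by simp
next
  case (Neg \<phi>)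
  show ?case using Neg.IH[of e e' f] Neg.prems by simp
qed simp_all

text \<open>Quantities stay fixed, so only the body assignment is transported. Surjectivity of
  \<open>\<sigma>\<close> carries the body quantifier, injectivity carries equality.\<close>

lemma sat_automorphism:
  assumes bij: "bij_betw \<sigma> (bodies M) (bodies M)"
    and iob: "\<And>b. b \<in> bodies M \<Longrightarrow> \<sigma> b \<in> IOb M \<longleftrightarrow> b \<in> IOb M"
    and ph: "\<And>b. b \<in> bodies M \<Longrightarrow> \<sigma> b \<in> Ph M \<longleftrightarrow> b \<in> Ph M"
    and W: "\<And>k b x. k \<in> bodies M \<Longrightarrow> b \<in> bodies M \<Longrightarrow> Wrel M (\<sigma> k) (\<sigma> b) x \<longleftrightarrow> Wrel M k b x"
    and Mr: "\<And>k b q. k \<in> bodies M \<Longrightarrow> b \<in> bodies M \<Longrightarrow> Mrel M (\<sigma> k) (\<sigma> b) q \<longleftrightarrow> Mrel M k b q"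
    and e: "range e \<subseteq> bodies M"
  shows "sat M (\<sigma> \<circ> e) f \<phi> \<longleftrightarrow> sat M e f \<phi>"
  using e
proof (induction \<phi> arbitrary: e f)
  case (EqB u v)
  then have "e u \<in> bodies M" "e v \<in> bodies M"
    by auto
  then show ?case using bij by (auto simp: bij_betw_def inj_on_def)
next
  case (ExB u \<phi>)
  have upd: "(\<sigma> \<circ> e)(u := \<sigma> b) = \<sigma> \<circ> e(u := b)" for b
    by auto
  have "sat M ((\<sigma> \<circ> e)(u := \<sigma> b)) f \<phi> \<longleftrightarrow> sat M (e(u := b)) f \<phi>" if "b \<in> bodies M" for b
    unfolding upd by (rule ExB.IH) (use ExB.prems that in auto)
  then have "sat M e f (ExB u \<phi>) \<longleftrightarrow> (\<exists>b\<in>\<sigma> ` bodies M. sat M ((\<sigma> \<circ> e)(u := b)) f \<phi>)"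
    by simp
  also have "\<sigma> ` bodies M = bodies M"
    using bij by (simp add: bij_betw_def)
  finally show ?case by (simp only: sat.simps)
qed (use iob ph W Mr in \<open>auto simp: image_subset_iff\<close>)

text \<open>The automorphism taking \<open>k\<close> to \<open>h\<close> also moves the values of
  all other body variables, but only \<open>u\<close> is free in \<open>\<phi>\<close>, so these
  values can be restored afterwards.\<close>

lemma SPRplus_inst_by_automorphism:
  fixes M :: "('a, 'b) model"
  assumes "freeB \<phi> \<subseteq> {u}" "IOb M \<subseteq> bodies M"
    and "\<And>k h. k \<in> IOb M \<Longrightarrow> h \<in> IOb M \<Longrightarrow> \<exists>\<sigma>. \<sigma> k = h \<and>
        bij_betw \<sigma> (bodies M) (bodies M) \<and>
        (\<forall>b\<in>bodies M. \<sigma> b \<in> IOb M \<longleftrightarrow> b \<in> IOb M) \<and>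
        (\<forall>b\<in>bodies M. \<sigma> b \<in> Ph M \<longleftrightarrow> b \<in> Ph M) \<and>
        (\<forall>k\<in>bodies M. \<forall>b\<in>bodies M. \<forall>x. Wrel M (\<sigma> k) (\<sigma> b) x \<longleftrightarrow> Wrel M k b x) \<and>
        (\<forall>k\<in>bodies M. \<forall>b\<in>bodies M. \<forall>q. Mrel M (\<sigma> k) (\<sigma> b) q \<longleftrightarrow> Mrel M k b q)"
  shows "SPRplus_inst \<phi> u M"
  unfolding SPRplus_inst_def
proof (intro ballI allI impI)
  fix k h and e :: "nat \<Rightarrow> 'a" and f :: "nat \<Rightarrow> 'b"
  assume kh: "k \<in> IOb M" "h \<in> IOb M" and ef: "range e \<subseteq> bodies M \<and> range f \<subseteq> quants M"
  obtain \<sigma> where \<sigma>: "\<sigma> k = h" "bij_betw \<sigma> (bodies M) (bodies M)"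
        "\<forall>b\<in>bodies M. \<sigma> b \<in> IOb M \<longleftrightarrow> b \<in> IOb M"
        "\<forall>b\<in>bodies M. \<sigma> b \<in> Ph M \<longleftrightarrow> b \<in> Ph M"
        "\<forall>k\<in>bodies M. \<forall>b\<in>bodies M. \<forall>x. Wrel M (\<sigma> k) (\<sigma> b) x \<longleftrightarrow> Wrel M k b x"
        "\<forall>k\<in>bodies M. \<forall>b\<in>bodies M. \<forall>q. Mrel M (\<sigma> k) (\<sigma> b) q \<longleftrightarrow> Mrel M k b q"
    using assms(3)[OF kh] by blast
  have "range (e(u := k)) \<subseteq> bodies M"
    using ef kh assms(2) by auto
  then have "sat M (e(u := k)) f \<phi> \<longleftrightarrow> sat M (\<sigma> \<circ> e(u := k)) f \<phi>"
    by (intro sat_automorphism[symmetric]) (use \<sigma> in auto)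
  also have "\<dots> \<longleftrightarrow> sat M (e(u := h)) f \<phi>"
    by (rule sat_cong_freeB) (use assms(1) \<sigma>(1) in auto)
  finally show "sat M (e(u := k)) f \<phi> \<longleftrightarrow> sat M (e(u := h)) f \<phi>" .
qed

section \<open>Real quantities\<close>

definition real_quants :: "('b, real) model \<Rightarrow> bool" where
  "real_quants M \<longleftrightarrow> quants M = UNIV \<and> plusQ M = (+) \<and> timesQ M = (*) \<and> lessQ M = (<)"

context
  fixes M :: "('b, real) model"
  assumes rq: "real_quants M"
begin

lemma QR_simps:
  "carrier (QR M) = UNIV" "x \<oplus>\<^bsub>QR M\<^esub> y = x + y" "x \<otimes>\<^bsub>QR M\<^esub> y = x * y"
  "\<zero>\<^bsub>QR M\<^esub> = 0" "\<one>\<^bsub>QR M\<^esub> = 1" "lessQ M x y \<longleftrightarrow> x < y" "leQ M x y \<longleftrightarrow> x \<le> y"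
proof -
  show zero: "\<zero>\<^bsub>QR M\<^esub> = 0"
    using rq by (auto simp: QR_def real_quants_def intro!: the_equality)
  show one: "\<one>\<^bsub>QR M\<^esub> = 1"
    using rq by (auto simp: QR_def real_quants_def intro!: the_equality) (metis mult_1)
qed (use rq in \<open>auto simp: QR_def real_quants_def leQ_def\<close>)

lemma field_QR: "field (QR M)"
proof -
  have *: "\<exists>y. x * y = 1" if "x \<noteq> 0" for x :: real
    using that by (intro exI[of _ "1 / x"]) simp
  have "\<exists>y. y + x = 0" for x :: real
    by (intro exI[of _ "- x"]) simp
  then have "cring (QR M)"
    by (intro cringI abelian_groupI comm_monoidI) (simp_all add: QR_simps algebra_simps)
  then show ?thesis
    by (rule cring.cring_fieldI2) (use * in \<open>auto simp: QR_simps\<close>)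
qed

interpretation QR: field "QR M"
  by (rule field_QR)

lemma QR_minus: "x \<ominus>\<^bsub>QR M\<^esub> y = x - y" "\<ominus>\<^bsub>QR M\<^esub> y = - y"
proof -
  have "\<ominus>\<^bsub>QR M\<^esub> y \<oplus>\<^bsub>QR M\<^esub> y = \<zero>\<^bsub>QR M\<^esub>"
    by (rule QR.l_neg) (simp add: QR_simps)
  then show "\<ominus>\<^bsub>QR M\<^esub> y = - y"
    by (simp add: QR_simps)
  then show "x \<ominus>\<^bsub>QR M\<^esub> y = x - y"
    by (simp add: a_minus_def QR_simps)
qed

lemma QR_finsum: "finite A \<Longrightarrow> (\<Oplus>\<^bsub>QR M\<^esub>i\<in>A. g i) = sum g A"
proof (induction A rule: finite_induct)
  case empty
  show ?case by (simp only: QR.finsum_empty QR_simps sum.empty)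
next
  case (insert a A)
  have "(\<Oplus>\<^bsub>QR M\<^esub>i\<in>insert a A. g i) = g a \<oplus>\<^bsub>QR M\<^esub> (\<Oplus>\<^bsub>QR M\<^esub>i\<in>A. g i)"
    by (rule QR.finsum_insert) (use insert in \<open>simp_all add: QR_simps(1)\<close>)
  then show ?case
    using insert by (simp add: QR_simps(2))
qed

text \<open>The inverse of zero in an algebraic field is unspecified and need not agree with real
  division, hence the hypothesis.\<close>

lemma divQ_eq: "y \<noteq> 0 \<Longrightarrow> divQ M x y = x / y"
proof -
  assume "y \<noteq> 0"
  then have "y \<otimes>\<^bsub>QR M\<^esub> inv\<^bsub>QR M\<^esub> y = \<one>\<^bsub>QR M\<^esub>"
    by (intro QR.Units_r_inv) (simp add: QR.field_Units QR_simps)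
  then show ?thesis
    using \<open>y \<noteq> 0\<close> by (simp add: divQ_def QR_simps field_simps)
qed

lemma sqrtQ_eq: "0 \<le> x \<Longrightarrow> sqrtQ M x = sqrt x"
proof -
  assume "0 \<le> x"
  moreover have "y = sqrt x" if "0 \<le> y" "y * y = x" for y
    using that by (metis real_sqrt_unique power2_eq_square)
  ultimately have "(THE y. 0 \<le> y \<and> y * y = x) = sqrt x"
    by (intro the_equality) auto
  then show ?thesis
    using rq by (simp add: sqrtQ_def QR_simps real_quants_def)
qed

lemma absQ_eq: "absQ M x = \<bar>x\<bar>"
  by (simp add: absQ_def QR_simps QR_minus)

lemma time_dist_eq: "time_dist M x y = \<bar>x ! 0 - y ! 0\<bar>"
  by (simp add: time_dist_def absQ_eq QR_minus)

lemma space_dist_eq: "space_dist d M x y = sqrt (\<Sum>i\<in>{1..<d}. (x ! i - y ! i)\<^sup>2)"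
  by (simp add: space_dist_def QR_minus QR_simps QR_finsum sqrtQ_eq sum_nonneg power2_eq_square)

lemma AxEField_real: "AxEField M"
proof -
  have "\<exists>y. y * y = x" if "0 < x" for x :: real
    using that by (intro exI[of _ "sqrt x"]) simp
  then show ?thesis
    unfolding AxEField_def QR_simps using rq
    by (auto simp: field_QR real_quants_def QR_simps)
qed

end

section \<open>Poincare transformations\<close>

type_synonym vec = "nat \<Rightarrow> real"

locale minkowski =
  fixes d :: nat
  assumes dim: "2 \<le> d"
begin

definition proj :: "vec \<Rightarrow> vec" where
  "proj v = (\<lambda>i. if i < d then v i else 0)"

text \<open>Points of \<open>Q^d\<close> are represented as functions on all naturals that vanish
  from index \<open>d\<close> on, so that \<open>d\<close> can remain a locale parameter.\<close>

definition V :: "vec set" where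
  "V = {v. \<forall>i\<ge>d. v i = 0}"

definition inner :: "vec \<Rightarrow> vec \<Rightarrow> real" where
  "inner u v = u 0 * v 0 - (\<Sum>i\<in>{1..<d}. u i * v i)"

abbreviation Q :: "vec \<Rightarrow> real" where
  "Q v \<equiv> inner v v"

text \<open>The linear part of an affine map \<open>f\<close>.\<close>

definition lin :: "(vec \<Rightarrow> vec) \<Rightarrow> vec \<Rightarrow> vec" where
  "lin f p = (\<lambda>i. f p i - f (\<lambda>_. 0) i)"

text \<open>The first clause is affinity, in the form in which it acts on a parametrized
  half-line.\<close>

definition isometry :: "(vec \<Rightarrow> vec) \<Rightarrow> bool" where
  "isometry f \<longleftrightarrow>
     (\<forall>x p s. f (\<lambda>i. x i + s * p i) = (\<lambda>i. f x i + s * lin f p i)) \<and>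
     (\<forall>x. f (proj x) = f x) \<and> (\<forall>x. f x \<in> V) \<and> (\<forall>p. Q (lin f p) = Q p)"

text \<open>The neutral element is \<open>proj\<close>, so that a transformation is determined by its values on \<open>V\<close>.\<close>

definition poincare :: "(vec \<Rightarrow> vec) set" where
  "poincare = {f. isometry f \<and> (\<exists>g. isometry g \<and> f \<circ> g = proj \<and> g \<circ> f = proj)}"

lemma proj_V [simp]: "proj v \<in> V" "v \<in> V \<Longrightarrow> proj v = v"
  by (auto simp: proj_def V_def)

lemma V_eqI: "u \<in> V \<Longrightarrow> v \<in> V \<Longrightarrow> (\<And>i. i < d \<Longrightarrow> u i = v i) \<Longrightarrow> u = v"
  unfolding V_def fun_eq_iff
  by (metis (mono_tags) mem_Collect_eq not_less)

text \<open>The shape \<open>u i + s * v i\<close> is the common normal form for sums, differences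
  and multiples. It accounts for the explicit factors \<open>1\<close> and \<open>-1\<close> in
  later terms.\<close>

lemma V_combine: "u \<in> V \<Longrightarrow> v \<in> V \<Longrightarrow> (\<lambda>i. u i + s * v i) \<in> V"
  by (simp add: V_def)

lemma V_minus: "u \<in> V \<Longrightarrow> v \<in> V \<Longrightarrow> (\<lambda>i. u i - v i) \<in> V"
  by (simp add: V_def)

lemma V_zero [simp]: "(\<lambda>_. 0) \<in> V"
  by (simp add: V_def)

lemma inner_commute: "inner u v = inner v u"
  by (simp add: inner_def mult.commute)

lemma inner_combine: "inner (\<lambda>i. u i + s * v i) w = inner u w + s * inner v w"
  by (simp add: inner_def algebra_simps sum.distrib sum_distrib_left)

lemma inner_zero [simp]: "inner (\<lambda>_. 0) w = 0"
  by (simp add: inner_def)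

lemma inner_proj [simp]: "inner (proj u) v = inner u v" "inner u (proj v) = inner u v"
  using dim by (auto simp: inner_def proj_def intro!: sum.cong)

lemma Q_combine: "Q (\<lambda>i. u i + s * v i) = Q u + 2 * s * inner u v + s\<^sup>2 * Q v"
proof -
  have "Q (\<lambda>i. u i + s * v i) = inner u (\<lambda>i. u i + s * v i) + s * inner v (\<lambda>i. u i + s * v i)"
    by (rule inner_combine)
  also have "inner u (\<lambda>i. u i + s * v i) = Q u + s * inner u v"
    by (subst inner_commute) (simp add: inner_combine inner_commute)
  also have "inner v (\<lambda>i. u i + s * v i) = inner u v + s * Q v"
    by (subst inner_commute) (simp add: inner_combine)
  finally show ?thesis
    by (simp add: algebra_simps power2_eq_square)
qed

lemma Q_scale: "Q (\<lambda>i. s * v i) = s\<^sup>2 * Q v"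
  using Q_combine[of "\<lambda>_. 0" s v] by simp

lemma isometryD:
  assumes "isometry f"
  shows "f (\<lambda>i. x i + s * p i) = (\<lambda>i. f x i + s * lin f p i)"
    "f (proj x) = f x" "f x \<in> V" "Q (lin f p) = Q p"
  using assms by (auto simp: isometry_def)

lemma lin_V: "isometry f \<Longrightarrow> lin f p \<in> V"
  unfolding lin_def by (intro V_minus isometryD)

lemma lin_zero [simp]: "lin f (\<lambda>_. 0) = (\<lambda>_. 0)"
  by (simp add: lin_def)

lemma lin_combine:
  assumes "isometry f"
  shows "lin f (\<lambda>i. x i + s * p i) = (\<lambda>i. lin f x i + s * lin f p i)"
  by (subst lin_def, subst isometryD(1)[OF assms]) (auto simp: lin_def)

lemma lin_scale: "isometry f \<Longrightarrow> lin f (\<lambda>i. s * p i) = (\<lambda>i. s * lin f p i)"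
  using lin_combine[of f "\<lambda>_. 0" s p] by simp

lemma lin_diff:
  assumes "isometry f"
  shows "lin f (\<lambda>i. x i - y i) = (\<lambda>i. f x i - f y i)"
  using lin_combine[OF assms, of x "-1" y] by (simp add: lin_def)

lemma lin_sum:
  assumes "isometry f" "finite A"
  shows "lin f (\<lambda>j. \<Sum>i\<in>A. p i j) = (\<lambda>j. \<Sum>i\<in>A. lin f (p i) j)"
  using assms(2)
proof (induction A rule: finite_induct)
  case (insert a A)
  have "lin f (\<lambda>j. (\<Sum>i\<in>A. p i j) + 1 * p a j) = (\<lambda>j. (\<Sum>i\<in>A. lin f (p i) j) + 1 * lin f (p a) j)"
    by (simp only: lin_combine[OF assms(1)] insert.IH)
  then show ?case
    using insert by (simp add: add.commute)
qed simp

lemma lin_comp: "isometry f \<Longrightarrow> lin (f \<circ> g) p = lin f (lin g p)"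
  by (simp add: lin_def[of "f \<circ> g"] lin_def[of g] lin_diff)

lemma lin_proj: "lin proj p = proj p"
  by (auto simp: lin_def proj_def)

lemma isometry_comp:
  assumes "isometry f" "isometry g"
  shows "isometry (f \<circ> g)"
  using assms unfolding isometry_def[of "f \<circ> g"]
  by (auto simp: isometryD lin_comp)

lemma isometry_proj: "isometry proj"
  unfolding isometry_def lin_proj
proof (intro conjI allI)
  show "proj (\<lambda>i. x i + s * p i) = (\<lambda>i. proj x i + s * proj p i)" "proj (proj x) = proj x" for x s p
    by (auto simp: proj_def)
qed simp_all

lemma proj_poincare: "proj \<in> poincare"
  using isometry_proj by (auto simp: poincare_def intro!: exI[of _ proj] ext)

lemma poincare_isometry: "f \<in> poincare \<Longrightarrow> isometry f"
  by (simp add: poincare_def)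

lemma poincare_inverse:
  assumes "f \<in> poincare"
  obtains g where "g \<in> poincare" "f \<circ> g = proj" "g \<circ> f = proj"
  using assms by (auto simp: poincare_def)

lemma isometry_comp_proj:
  assumes "isometry f"
  shows "f \<circ> proj = f" "proj \<circ> f = f"
  using isometryD[OF assms] by auto

lemma poincare_comp:
  assumes "f \<in> poincare" "g \<in> poincare"
  shows "f \<circ> g \<in> poincare"
proof -
  obtain f' where f': "f' \<in> poincare" "f \<circ> f' = proj" "f' \<circ> f = proj"
    using poincare_inverse assms(1) by blast
  obtain g' where g': "g' \<in> poincare" "g \<circ> g' = proj" "g' \<circ> g = proj"
    using poincare_inverse assms(2) by blast
  note iso = assms[THEN poincare_isometry] f'(1)[THEN poincare_isometry] g'(1)[THEN poincare_isometry]
  have "(f \<circ> g) \<circ> (g' \<circ> f') = (f \<circ> (g \<circ> g')) \<circ> f'" "(g' \<circ> f') \<circ> (f \<circ> g) = (g' \<circ> (f' \<circ> f)) \<circ> g"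
    by (simp_all add: comp_assoc)
  then have "(f \<circ> g) \<circ> (g' \<circ> f') = proj" "(g' \<circ> f') \<circ> (f \<circ> g) = proj"
    by (simp_all add: f' g' isometry_comp_proj iso)
  then show ?thesis
    using iso by (auto simp: poincare_def intro!: isometry_comp exI[of _ "g' \<circ> f'"])
qed

lemma poincare_inj:
  assumes "f \<in> poincare" "x \<in> V" "y \<in> V"
  shows "f x = f y \<longleftrightarrow> x = y"
proof -
  obtain g where g: "g \<circ> f = proj"
    using assms(1) by (rule poincare_inverse)
  have "g (f x) = x" "g (f y) = y"
    using assms(2,3) fun_cong[OF g, of x] fun_cong[OF g, of y] by simp_all
  then show ?thesis by metis
qed

lemma poincare_surj:
  assumes "f \<in> poincare" "y \<in> V"
  obtains x where "x \<in> V" "f x = y"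
proof -
  obtain g where g: "g \<in> poincare" "f \<circ> g = proj"
    using assms(1) by (rule poincare_inverse)
  show ?thesis
  proof (rule that)
    show "g y \<in> V"
      by (intro isometryD poincare_isometry g)
    show "f (g y) = y"
      using assms(2) fun_cong[OF g(2), of y] by simp
  qed
qed

lemma lin_inverse:
  assumes "isometry g" "g \<circ> f = proj"
  shows "lin g (lin f p) = proj p"
  by (simp only: lin_comp[OF assms(1), symmetric] assms(2) lin_proj)

lemma lin_eq_0_iff:
  assumes "f \<in> poincare" "p \<in> V"
  shows "lin f p = (\<lambda>_. 0) \<longleftrightarrow> p = (\<lambda>_. 0)"
proof
  assume *: "lin f p = (\<lambda>_. 0)"
  obtain g where g: "g \<in> poincare" "g \<circ> f = proj"
    using assms(1) by (rule poincare_inverse)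
  have "lin g (lin f p) = proj p"
    by (rule lin_inverse[OF poincare_isometry[OF g(1)] g(2)])
  then show "p = (\<lambda>_. 0)"
    using assms(2) * by simp
qed simp

section \<open>Translations and reflections; observers through two timelike separated events\<close>

definition translation :: "vec \<Rightarrow> vec \<Rightarrow> vec" where
  "translation a x = proj (\<lambda>i. x i + a i)"

lemma lin_translation: "lin (translation a) p = proj p"
  by (auto simp: lin_def translation_def proj_def)

lemma isometry_translation: "isometry (translation a)"
  unfolding isometry_def lin_translation
proof (intro conjI allI)
  show "translation a (\<lambda>i. x i + s * p i) = (\<lambda>i. translation a x i + s * proj p i)"
    "translation a (proj x) = translation a x" for x s p
    by (auto simp: translation_def proj_def)
qed (simp_all add: translation_def)

lemma translation_poincare: "translation a \<in> poincare"
proof -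
  have "translation a \<circ> translation (\<lambda>i. - a i) = proj" "translation (\<lambda>i. - a i) \<circ> translation a = proj"
    by (auto simp: translation_def proj_def fun_eq_iff)
  then show ?thesis
    using isometry_translation by (auto simp: poincare_def)
qed

text \<open>The Minkowski reflection in the hyperplane orthogonal to \<open>w\<close>. As an
  involution it is its own inverse in \<open>poincare\<close>, which makes it handier than an
  explicit boost.\<close>

definition reflection :: "vec \<Rightarrow> vec \<Rightarrow> vec" where
  "reflection w x = proj (\<lambda>i. x i + (- 2 * inner x w / Q w) * w i)"

lemma reflection_zero: "reflection w (\<lambda>_. 0) = (\<lambda>_. 0)"
  by (auto simp: reflection_def proj_def)

lemma lin_reflection: "lin (reflection w) = reflection w"
  by (simp add: lin_def fun_eq_iff reflection_zero)

lemma isometry_reflection: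
  assumes "Q w \<noteq> 0"
  shows "isometry (reflection w)"
  unfolding isometry_def lin_reflection
proof (intro conjI allI)
  fix x p :: vec and s :: real
  show "reflection w (\<lambda>i. x i + s * p i) = (\<lambda>i. reflection w x i + s * reflection w p i)"
    by (auto simp: reflection_def proj_def inner_combine algebra_simps add_divide_distrib
        diff_divide_distrib)
  show "reflection w (proj x) = reflection w x"
    unfolding reflection_def inner_proj by (auto simp: proj_def)
  show "reflection w x \<in> V"
    by (simp add: reflection_def)
  have "Q (reflection w p) = Q (\<lambda>i. p i + (- 2 * inner p w / Q w) * w i)"
    by (simp only: reflection_def inner_proj)
  also have "\<dots> = Q p"
    using assms by (simp only: Q_combine) (simp add: field_simps power2_eq_square)
  finally show "Q (reflection w p) = Q p" .
qed

lemma reflection_involution: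
  assumes "Q w \<noteq> 0"
  shows "reflection w \<circ> reflection w = proj"
proof (rule ext)
  fix x
  have "inner (reflection w x) w = inner x w + (- 2 * inner x w / Q w) * Q w"
    by (simp only: reflection_def inner_proj inner_combine)
  then have "inner (reflection w x) w = - inner x w"
    using assms by simp
  then have "reflection w (reflection w x) = proj (\<lambda>i. reflection w x i + 2 * inner x w / Q w * w i)"
    by (simp add: reflection_def[of w "reflection w x"])
  also have "\<dots> = proj x"
    by (auto simp: reflection_def proj_def)
  finally show "(reflection w \<circ> reflection w) x = proj x"
    by simp
qed

lemma reflection_poincare: "Q w \<noteq> 0 \<Longrightarrow> reflection w \<in> poincare"
  using isometry_reflection reflection_involution by (auto simp: poincare_def)

text \<open>The reflection in the difference \<open>w\<close> of \<open>v\<close> and the vector of equal Minkowski norm on the time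
  axis exchanges the two.  When \<open>v\<close> itself is on the axis, \<open>w\<close> may be \<open>0\<close>.\<close>

lemma exists_lorentz_to_time_axis:
  assumes "v \<in> V" "0 < Q v"
  obtains f where "f \<in> poincare" "\<And>i. 0 < i \<Longrightarrow> lin f v i = 0"
proof (cases "\<forall>i>0. v i = 0")
  case True
  show ?thesis
    by (rule that[OF proj_poincare]) (use True assms in \<open>simp add: lin_proj\<close>)
next
  case False
  define n where "n = sqrt (Q v)"
  define w where "w = (\<lambda>i. v i + (- n) * (if i = 0 then 1 else 0))"
  obtain i where i: "0 < i" "v i \<noteq> 0"
    using False by auto
  have "i < d"
  proof (rule ccontr)
    assume "\<not> i < d"
    then show False
      using i assms(1) by (simp add: V_def)
  qed
  then have "0 < (\<Sum>i\<in>{1..<d}. v i * v i)"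
    by (intro sum_pos2[of _ i]) (use i in \<open>auto simp flip: power2_eq_square\<close>)
  then have lt: "n\<^sup>2 < (v 0)\<^sup>2" and n2: "n\<^sup>2 = Q v"
    using assms(2) by (simp_all add: n_def inner_def power2_eq_square)
  have "n > 0" using assms(2) by (simp add: n_def)
  have e0: "inner u (\<lambda>i. if i = 0 then 1 else 0) = u 0" for u
    by (simp add: inner_def)
  have vw: "inner v w = n\<^sup>2 - n * v 0"
  proof -
    have "inner w v = Q v + (- n) * inner (\<lambda>i. if i = 0 then 1 else 0) v"
      unfolding w_def by (rule inner_combine)
    then show ?thesis
      by (simp add: e0 n2 inner_commute[of w] inner_commute[of "\<lambda>i. if i = 0 then 1 else 0"])
  qed
  \<comment> \<open>The two vectors exchanged have equal norm, which yields
    \<open>Q w = 2 * inner v w\<close>; hence the reflection subtracts exactly \<open>w\<close> from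
    \<open>v\<close> and leaves \<open>n\<close> on the time axis. It also gives
    \<open>Q w = 2 * n * (n - v 0)\<close>, nonzero because a spatial component of \<open>v\<close>
    forces \<open>n\<^sup>2 < (v 0)\<^sup>2\<close>.\<close>
  have Qw: "Q w = 2 * inner v w"
    unfolding vw unfolding w_def
    by (subst Q_combine, subst e0, subst e0) (simp add: n2[symmetric] power2_eq_square algebra_simps)
  have "Q w \<noteq> 0"
    using lt \<open>n > 0\<close> unfolding Qw vw by (auto simp: power2_eq_square)
  show ?thesis
  proof (rule that)
    show "reflection w \<in> poincare"
      by (rule reflection_poincare) fact
    show "lin (reflection w) v i = 0" if "0 < i" for i
      using that \<open>Q w \<noteq> 0\<close> Qw assms(1)
      by (auto simp: lin_reflection reflection_def proj_def w_def)
  qed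
qed

text \<open>A Lorentz map brings the difference of the events to the time axis, and a translation
  then moves \<open>x\<close> to the origin. An observer's own world-line is the preimage of its
  time axis, so this supplies the observers that the existence axiom demands.\<close>

lemma exists_observer_through:
  assumes "x \<in> V" "y \<in> V" "0 < Q (\<lambda>i. y i - x i)"
  obtains f where "f \<in> poincare" "\<And>i. 0 < i \<Longrightarrow> f x i = 0" "\<And>i. 0 < i \<Longrightarrow> f y i = 0"
proof -
  define v where "v = (\<lambda>i. y i - x i)"
  obtain g where g: "g \<in> poincare" "\<And>i. 0 < i \<Longrightarrow> lin g v i = 0"
    using exists_lorentz_to_time_axis[of v] assms V_minus by (auto simp: v_def)
  define f where "f = translation (\<lambda>i. - g x i) \<circ> g"
  have f: "f \<in> poincare"
    unfolding f_def by (intro poincare_comp translation_poincare g)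
  have fx: "f x = (\<lambda>_. 0)"
    by (auto simp: f_def translation_def proj_def)
  have "lin f v = proj (lin g v)"
    by (simp add: f_def lin_comp isometry_translation lin_translation)
  then have "f y = proj (lin g v)"
    using lin_diff[OF poincare_isometry[OF f], of y x] by (simp add: v_def fx)
  then have "f y i = 0" if "0 < i" for i
    using g(2)[OF that] by (simp add: proj_def)
  then show ?thesis
    using that f fx by auto
qed

text \<open>An affine map is determined by \<open>d + 1\<close> values. The index
  \<open>j = d\<close> stands for the origin, because \<open>proj\<close> cuts that basis vector
  off; the other values are then added one coordinate at a time.\<close>

lemma isometry_eqI:
  assumes f: "isometry f" and g: "isometry g"
    and eq: "\<And>j. j \<le> d \<Longrightarrow> f (\<lambda>i. if i = j then 1 else 0) = g (\<lambda>i. if i = j then 1 else 0)"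
  shows "f = g"
proof
  fix x
  have zero: "f (\<lambda>_. 0) = g (\<lambda>_. 0)"
  proof -
    have p: "proj (\<lambda>i. if i = d then 1 else 0) = (\<lambda>_. 0)"
      by (auto simp: proj_def)
    show ?thesis
      using eq[of d] isometryD(2)[OF f, of "\<lambda>i. if i = d then 1 else 0"]
        isometryD(2)[OF g, of "\<lambda>i. if i = d then 1 else 0"] unfolding p by simp
  qed
  have "f (\<lambda>i. if i < n then x i else 0) = g (\<lambda>i. if i < n then x i else 0)" if "n \<le> d" for n
    using that
  proof (induction n)
    case 0
    then show ?case by (simp add: zero)
  next
    case (Suc n)
    have *: "(\<lambda>i. if i < Suc n then x i else 0) =
        (\<lambda>i. (if i < n then x i else 0) + x n * (if i = n then 1 else 0))"
      by (auto simp: less_Suc_eq)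
    show ?case
      unfolding * isometryD(1)[OF f] isometryD(1)[OF g] lin_def
      using Suc eq[of n] zero by simp
  qed
  then have "f (proj x) = g (proj x)"
    by (simp add: proj_def)
  then show "f x = g x"
    by (simp add: isometryD f g)
qed

end

section \<open>Bodies\<close>

text \<open>Iterated pairing alone does not reveal the length of a list, so the length is stored
  next to the code.\<close>

lemma exists_inj_list_to_base:
  assumes "infinite (UNIV :: 'a set)"
  shows "\<exists>e :: 'a list \<Rightarrow> 'a. inj e"
proof -
  have "\<exists>p. bij_betw p ((UNIV :: 'a set) \<times> (UNIV :: 'a set)) (UNIV :: 'a set)"
    unfolding card_of_ordIso by (rule card_of_Times_same_infinite[OF assms])
  then obtain p :: "'a \<times> 'a \<Rightarrow> 'a" where p: "inj p"
    by (auto simp: bij_betw_def)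
  obtain c :: "nat \<Rightarrow> 'a" where c: "inj c"
    using assms infinite_countable_subset by blast
  define code where "code xs = foldr (\<lambda>x y. p (x, y)) xs (c 0)" for xs
  have "xs = ys" if "length xs = length ys" "code xs = code ys" for xs ys
    using that
    by (induction xs ys rule: list_induct2) (auto simp: code_def dest: injD[OF p])
  then have "inj (\<lambda>xs :: 'a list. p (c (length xs), code xs))"
    by (intro injI) (auto dest!: injD[OF p] injD[OF c])
  then show ?thesis
    by blast
qed

text \<open>\<open>Obs f\<close> is the inertial observer with coordinate map \<open>f\<close> on a fixed reference frame, and
  \<open>Part x p\<close> is a body occupying the half-line from \<open>x\<close> in direction of its four-momentum \<open>p\<close>.
  An observer for whom the time component of \<open>p\<close> is negative sees it as incoming, with
  four-momentum \<open>-p\<close>.\<close>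

datatype body = Obs "vec \<Rightarrow> vec" | Part vec vec

context minkowski
begin

text \<open>A nonzero momentum gives a world-line with two distinct events. Null vectors belong to
  both versions, since the light signals are the bodies with null momentum.\<close>

definition Momenta :: "bool \<Rightarrow> vec set" where
  "Momenta ftl = {p \<in> V. p \<noteq> (\<lambda>_. 0) \<and> (ftl \<or> 0 \<le> Q p)}"

definition Bodies :: "bool \<Rightarrow> body set" where
  "Bodies ftl = {Obs f | f. f \<in> poincare} \<union> {Part x p | x p. x \<in> V \<and> p \<in> Momenta ftl}"

definition unit_time :: vec where
  "unit_time = (\<lambda>i. if i = 0 then 1 else 0)"

lemma Q_unit_time: "Q unit_time = 1"
  by (simp add: inner_def unit_time_def)

lemma unit_time_Momenta: "unit_time \<in> Momenta ftl"
  using dim Q_unit_time by (auto simp: Momenta_def V_def unit_time_def fun_eq_iff)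

text \<open>The head separates the constructors. For an observer, entry \<open>n\<close> is
  coordinate \<open>n mod d\<close> of the image of basis vector \<open>n div d\<close>; as
  \<open>n div d\<close> runs from 0 to \<open>d\<close>, these are the values that
  \<open>isometry_eqI\<close> asks for.\<close>

fun body_code :: "body \<Rightarrow> real list" where
  "body_code (Obs f) =
     0 # map (\<lambda>n. f (\<lambda>i. if i = n div d then 1 else 0) (n mod d)) [0..<Suc d * d]"
| "body_code (Part x p) = 1 # map x [0..<d] @ map p [0..<d]"

lemma inj_on_body_code: "inj_on body_code (Bodies ftl)"
proof -
  have "f = g" if "f \<in> poincare" "g \<in> poincare" "body_code (Obs f) = body_code (Obs g)" for f g
  proof (rule isometry_eqI)
    show "isometry f" "isometry g"
      using that poincare_isometry by blast+
    fix j assume "j \<le> d"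
    have "f (\<lambda>i. if i = j then 1 else 0) i = g (\<lambda>i. if i = j then 1 else 0) i" if "i < d" for i
    proof -
      have "j * d + i < j * d + d"
        using \<open>i < d\<close> by simp
      also have "\<dots> \<le> Suc d * d"
        using mult_le_mono1[OF \<open>j \<le> d\<close>, of d] by simp
      finally have "j * d + i < Suc d * d" .
      moreover have "(j * d + i) div d = j" "(j * d + i) mod d = i"
        using \<open>i < d\<close> by auto
      ultimately show ?thesis
        using \<open>body_code (Obs f) = body_code (Obs g)\<close>
        by (auto simp del: upt_Suc mult_Suc dest!: bspec[of _ _ "j * d + i"])
    qed
    then show "f (\<lambda>i. if i = j then 1 else 0) = g (\<lambda>i. if i = j then 1 else 0)"
      using \<open>isometry f\<close> \<open>isometry g\<close> by (intro V_eqI isometryD)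
  qed
  moreover have "x = y \<and> p = q"
    if "x \<in> V" "p \<in> V" "y \<in> V" "q \<in> V" "body_code (Part x p) = body_code (Part y q)" for x p y q
    using that by (auto intro!: V_eqI)
  moreover have "body_code (Obs f) \<noteq> body_code (Part x p)" for f x p
    by simp
  ultimately show ?thesis
    unfolding inj_on_def Bodies_def Momenta_def by (auto simp del: body_code.simps dest: sym)
qed

text \<open>There are continuum many bodies: particles starting at different points of the time axis
  embed the reals, and the codes embed the bodies into the reals. The whole type \<open>real\<close>
  can therefore serve as the sort of bodies.\<close>

lemma exists_bij_Bodies: "\<exists>dec :: real \<Rightarrow> body. bij_betw dec UNIV (Bodies ftl)"
proof -
  obtain e :: "real list \<Rightarrow> real" where e: "inj e"
    using exists_inj_list_to_base[OF infinite_UNIV_char_0] by blast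
  define point where "point r = (\<lambda>i. r * unit_time i)" for r
  have "inj_on (\<lambda>r. Part (point r) unit_time) UNIV"
    by (rule injI) (auto simp: point_def unit_time_def dest!: fun_cong[of _ _ 0])
  moreover have "(\<lambda>r. Part (point r) unit_time) ` UNIV \<subseteq> Bodies ftl"
    using unit_time_Momenta dim by (auto simp: Bodies_def point_def V_def unit_time_def)
  moreover have "inj_on (e \<circ> body_code) (Bodies ftl)"
    using inj_on_body_code e by (meson comp_inj_on inj_on_subset subset_UNIV)
  ultimately show ?thesis
    by (rule Schroeder_Bernstein) simp
qed

end

section \<open>The two models\<close>

locale srdyn_model = minkowski +
  fixes ftl :: bool and dec :: "real \<Rightarrow> body"
  assumes bij_dec: "bij_betw dec UNIV (Bodies ftl)"
begin

definition coords :: "real list \<Rightarrow> vec" where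
  "coords xs = (\<lambda>i. if i < d then xs ! i else 0)"

definition of_coords :: "vec \<Rightarrow> real list" where
  "of_coords v = map v [0..<d]"

text \<open>World-lines in the common reference frame, which each observer sees through its
  coordinate map. The trace of an observer is pulled back from its time axis, as
  \<open>AxSelf\<close> requires.\<close>

fun trace :: "body \<Rightarrow> vec set" where
  "trace (Obs g) = {x \<in> V. \<forall>i>0. g x i = 0}"
| "trace (Part x p) = {\<lambda>i. x i + t * p i | t. 0 \<le> t}"

text \<open>A mass is 0 rather than undefined where the time component vanishes, so a particle
  remains one for observers to whom its velocity is undefined. Observers get no mass and hence are
  not particles.\<close>

definition Mod :: "(real, real) model" where
  "Mod = \<lparr>bodies = UNIV, quants = UNIV,
     IOb = {k. \<exists>f. dec k = Obs f},
     Ph = {b. \<exists>x p. dec b = Part x p \<and> Q p = 0},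
     plusQ = (+), timesQ = (*), lessQ = (<),
     Wrel = (\<lambda>k b xs. length xs = d \<and> (\<exists>f. dec k = Obs f \<and> coords xs \<in> f ` trace (dec b))),
     Mrel = (\<lambda>k b q. \<exists>f x p. dec k = Obs f \<and> dec b = Part x p \<and> q = \<bar>lin f p 0\<bar>)\<rparr>"

lemma real_quants_Mod: "real_quants Mod"
  by (simp add: Mod_def real_quants_def)

lemmas Mod_real = QR_simps[OF real_quants_Mod] QR_minus[OF real_quants_Mod]
  QR_finsum[OF real_quants_Mod] divQ_eq[OF real_quants_Mod] time_dist_eq[OF real_quants_Mod]
  space_dist_eq[OF real_quants_Mod]

lemma Mod_simps [simp]:
  "bodies Mod = UNIV" "quants Mod = UNIV" "k \<in> IOb Mod \<longleftrightarrow> (\<exists>f. dec k = Obs f)"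
  "b \<in> Ph Mod \<longleftrightarrow> (\<exists>x p. dec b = Part x p \<and> Q p = 0)"
  "xs \<in> points d Mod \<longleftrightarrow> length xs = d"
  by (simp_all add: Mod_def points_def)

lemma Wrel_Mod:
  "Wrel Mod k b xs \<longleftrightarrow> length xs = d \<and> (\<exists>f. dec k = Obs f \<and> coords xs \<in> f ` trace (dec b))"
  by (simp add: Mod_def)

lemma Mrel_Mod:
  "Mrel Mod k b q \<longleftrightarrow> (\<exists>f x p. dec k = Obs f \<and> dec b = Part x p \<and> q = \<bar>lin f p 0\<bar>)"
  by (simp add: Mod_def)

lemma is_model_Mod: "is_model d Mod"
  unfolding is_model_def Wrel_Mod Mrel_Mod by simp

lemma coords_simps [simp]:
  "coords xs \<in> V" "coords (of_coords v) = proj v" "length (of_coords v) = d"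
  "length xs = d \<Longrightarrow> of_coords (coords xs) = xs" "i < d \<Longrightarrow> coords xs i = xs ! i"
  "i < d \<Longrightarrow> of_coords v ! i = v i"
  by (auto simp: coords_def of_coords_def V_def proj_def intro: nth_equalityI)

lemma dim_pos [simp]: "0 < d"
  using dim by simp

lemma dec_in_Bodies: "dec b \<in> Bodies ftl"
  using bij_dec by (auto simp: bij_betw_def)

lemma exists_dec: "c \<in> Bodies ftl \<Longrightarrow> \<exists>b. dec b = c"
  using bij_dec by (metis bij_betw_iff_bijections)

lemma dec_Obs: "dec k = Obs f \<Longrightarrow> f \<in> poincare"
  using dec_in_Bodies[of k] by (auto simp: Bodies_def)

lemma dec_Part:
  assumes "dec b = Part x p"
  shows "x \<in> V" "p \<in> Momenta ftl" "p \<in> V" "p \<noteq> (\<lambda>_. 0)"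
  using dec_in_Bodies[of b] unfolding assms by (auto simp: Bodies_def Momenta_def)

lemma exists_Obs: "f \<in> poincare \<Longrightarrow> \<exists>k. dec k = Obs f"
  by (intro exists_dec) (simp add: Bodies_def)

lemma exists_Part: "x \<in> V \<Longrightarrow> p \<in> Momenta ftl \<Longrightarrow> \<exists>b. dec b = Part x p"
  by (intro exists_dec) (simp add: Bodies_def)

lemma trace_V: "trace (dec b) \<subseteq> V"
  using dec_in_Bodies[of b] by (cases "dec b") (auto simp: Bodies_def Momenta_def V_combine)

lemma event:
  assumes "dec k = Obs f"
  obtains X where "X \<in> V" "coords xs = f X"
proof -
  obtain X where "X \<in> V" "f X = coords xs"
    using poincare_surj[OF dec_Obs[OF assms] coords_simps(1)] .
  then show ?thesis
    using that[of X] by simp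
qed

text \<open>Naming a coordinate point by its event \<open>X\<close> in the reference frame removes
  the observer from the right-hand side, so that statements about two observers become statements
  about events.\<close>

lemma Wrel_iff:
  assumes "dec k = Obs f" "length xs = d" "X \<in> V" "coords xs = f X"
  shows "Wrel Mod k b xs \<longleftrightarrow> X \<in> trace (dec b)"
proof -
  have "f X \<in> f ` trace (dec b) \<longleftrightarrow> X \<in> trace (dec b)"
    using poincare_inj[OF dec_Obs[OF assms(1)] assms(3)] trace_V[of b]
    by (metis imageE image_eqI subset_iff)
  then show ?thesis
    using assms by (simp add: Wrel_Mod)
qed

lemma Momenta_scale:
  assumes "p \<in> Momenta ftl" "s \<noteq> 0"
  shows "(\<lambda>i. s * p i) \<in> Momenta ftl"
proof -
  obtain i where "p i \<noteq> 0"
    using assms(1) by (auto simp: Momenta_def)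
  then have "(\<lambda>i. s * p i) \<noteq> (\<lambda>_. 0)"
    using assms(2) by (metis mult_eq_0_iff)
  then show ?thesis
    using assms(1) by (auto simp: Momenta_def V_def Q_scale)
qed

lemma Momenta_lin:
  assumes "p \<in> Momenta ftl" "f \<in> poincare"
  shows "lin f p \<in> Momenta ftl"
  using assms lin_eq_0_iff[OF assms(2), of p] poincare_isometry[OF assms(2)]
  by (auto simp: Momenta_def lin_V isometryD(4))

lemma trace_Part:
  assumes "0 \<le> t"
  shows "x \<in> trace (Part x p)" "(\<lambda>i. x i + t * p i) \<in> trace (Part x p)"
proof -
  show "(\<lambda>i. x i + t * p i) \<in> trace (Part x p)"
    using assms by auto
  have "(\<lambda>i. x i + 0 * p i) \<in> trace (Part x p)"
    unfolding trace.simps by blast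
  then show "x \<in> trace (Part x p)"
    by simp
qed

text \<open>The bodies present determine the event: two particles that leave \<open>X\<close> in
  opposite directions of time have only \<open>X\<close> in common.\<close>

lemma same_event_iff:
  assumes k: "dec k = Obs f" "length xs = d" "X \<in> V" "coords xs = f X"
    and h: "dec h = Obs g" "length ys = d" "Y \<in> V" "coords ys = g Y"
  shows "same_event Mod k xs h ys \<longleftrightarrow> X = Y"
proof
  assume same: "same_event Mod k xs h ys"
  obtain b where b: "dec b = Part X unit_time"
    using exists_Part[OF \<open>X \<in> V\<close> unit_time_Momenta] by blast
  have "(\<lambda>i. -1 * unit_time i) \<in> Momenta ftl"
    by (rule Momenta_scale[OF unit_time_Momenta]) simp
  then obtain c where c: "dec c = Part X (\<lambda>i. -1 * unit_time i)"
    using exists_Part[OF \<open>X \<in> V\<close>] by blast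
  have X: "X \<in> trace (dec b)" "X \<in> trace (dec c)"
    unfolding b c by (rule trace_Part order_refl)+
  have "Y \<in> trace (dec b)" "Y \<in> trace (dec c)"
    using same X Wrel_iff[OF k] Wrel_iff[OF h] by (auto simp: same_event_def)
  then obtain s t where "0 \<le> s" "0 \<le> t" and Y: "Y = (\<lambda>i. X i + s * unit_time i)"
    "Y = (\<lambda>i. X i + t * (-1 * unit_time i))"
    unfolding b c by auto
  then have "s = 0"
    using fun_cong[OF Y(1), of 0] fun_cong[OF Y(2), of 0] by (simp add: unit_time_def)
  then show "X = Y"
    using Y by simp
next
  assume "X = Y"
  then show "same_event Mod k xs h ys"
    using Wrel_iff[OF k] Wrel_iff[OF h] by (simp add: same_event_def)
qed

lemma Q_coords_diff:
  "Q (\<lambda>i. coords xs i - coords ys i) = (xs ! 0 - ys ! 0)\<^sup>2 - (\<Sum>i\<in>{1..<d}. (xs ! i - ys ! i)\<^sup>2)"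
  by (simp add: inner_def power2_eq_square)

text \<open>With both distances written as square roots, comparing space with time amounts to
  comparing \<open>Q\<close> of the difference with 0. For this reason \<open>real_sqrt_abs\<close>
  is later kept from rewriting the first form.\<close>

lemma time_space_Mod:
  "time_dist Mod xs ys = sqrt ((xs ! 0 - ys ! 0)\<^sup>2)"
  "space_dist d Mod xs ys = sqrt ((xs ! 0 - ys ! 0)\<^sup>2 - Q (\<lambda>i. coords xs i - coords ys i))"
  unfolding Q_coords_diff by (simp_all add: Mod_real)

lemma Q_event_diff:
  assumes "f \<in> poincare" "coords xs = f X" "coords ys = f Y"
  shows "Q (\<lambda>i. coords xs i - coords ys i) = Q (\<lambda>i. X i - Y i)"
  using isometryD(4)[OF poincare_isometry[OF assms(1)], of "\<lambda>i. X i - Y i"]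
    lin_diff[OF poincare_isometry[OF assms(1)], of X Y]
  by (simp add: assms)

section \<open>Kinematic axioms on events and light\<close>

lemma AxEv_Mod: "AxEv d Mod"
  unfolding AxEv_def
proof (intro ballI)
  fix k h xs
  assume "k \<in> IOb Mod" "h \<in> IOb Mod" "xs \<in> points d Mod"
  then obtain f g where fg: "dec k = Obs f" "dec h = Obs g" and xs: "length xs = d"
    by auto
  obtain X where X: "X \<in> V" "coords xs = f X"
    using event[OF fg(1)] .
  have "proj (g X) = g X"
    by (rule proj_V(2), rule isometryD(3), rule poincare_isometry, rule dec_Obs, rule fg)
  then have "same_event Mod k xs h (of_coords (g X))"
    using same_event_iff[OF fg(1) xs X fg(2) _ X(1)] by simp
  then show "\<exists>ys\<in>points d Mod. same_event Mod k xs h ys"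
    by (intro bexI[of _ "of_coords (g X)"]) simp_all
qed

lemma AxSelf_Mod: "AxSelf d Mod"
  unfolding AxSelf_def
proof (intro ballI)
  fix k xs
  assume "k \<in> IOb Mod" "xs \<in> points d Mod"
  then obtain f where f: "dec k = Obs f" and xs: "length xs = d"
    by auto
  obtain X where X: "X \<in> V" "coords xs = f X"
    using event[OF f] .
  have "Wrel Mod k k xs \<longleftrightarrow> (\<forall>i>0. coords xs i = 0)"
    using Wrel_iff[OF f xs X, of k] X by (simp add: f)
  also have "\<dots> \<longleftrightarrow> (\<forall>i\<in>{1..<d}. xs ! i = \<zero>\<^bsub>QR Mod\<^esub>)"
    by (auto simp: Mod_real coords_def)
  finally show "Wrel Mod k k xs \<longleftrightarrow> (\<forall>i\<in>{1..<d}. xs ! i = \<zero>\<^bsub>QR Mod\<^esub>)" .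
qed

text \<open>Events on one null half-line differ by a multiple of its null direction; conversely, of
  two events with null difference the second lies on the half-line from the first through it. Both
  \<open>AxLight\<close> and the light clause of \<open>AxSymD\<close> reduce to this.\<close>

lemma photon_through:
  assumes f: "dec k = Obs f" and "length xs = d" "length ys = d"
  shows "(\<exists>p\<in>Ph Mod. Wrel Mod k p xs \<and> Wrel Mod k p ys) \<longleftrightarrow>
    Q (\<lambda>i. coords xs i - coords ys i) = 0"
proof -
  obtain X where X: "X \<in> V" "coords xs = f X"
    using event[OF f] .
  obtain Y where Y: "Y \<in> V" "coords ys = f Y"
    using event[OF f] .
  have W: "Wrel Mod k b xs \<longleftrightarrow> X \<in> trace (dec b)" "Wrel Mod k b ys \<longleftrightarrow> Y \<in> trace (dec b)" for b
    using Wrel_iff[OF f] assms X Y by auto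
  have QXY: "Q (\<lambda>i. coords xs i - coords ys i) = Q (\<lambda>i. Y i - X i)"
    using Q_event_diff[OF dec_Obs[OF f] X(2) Y(2)] Q_scale[of "-1" "\<lambda>i. X i - Y i"] by simp
  show ?thesis
    unfolding QXY W
  proof
    assume "\<exists>p\<in>Ph Mod. X \<in> trace (dec p) \<and> Y \<in> trace (dec p)"
    then obtain z p s t where p: "Q p = 0" "X = (\<lambda>i. z i + s * p i)" "Y = (\<lambda>i. z i + t * p i)"
      by force
    then have "(\<lambda>i. Y i - X i) = (\<lambda>i. (t - s) * p i)"
      by (auto simp: algebra_simps)
    then show "Q (\<lambda>i. Y i - X i) = 0"
      by (simp add: Q_scale p)
  next
    assume null: "Q (\<lambda>i. Y i - X i) = 0"
    \<comment> \<open>The null direction (1,1,0,...,0), available since \<open>d\<close> is at least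
      2, serves the degenerate case \<open>X = Y\<close>, where the difference gives no
      direction.\<close>
    define n where "n = (\<lambda>i::nat. if i < 2 then 1 else 0 :: real)"
    have "(\<Sum>i\<in>{1..<d}. n i * n i) = (\<Sum>i\<in>{1..<2}. n i * n i)"
      using dim by (intro sum.mono_neutral_right) (auto simp: n_def)
    then have n: "Q n = 0"
      by (simp add: inner_def n_def numeral_2_eq_2)
    then have "n \<in> Momenta ftl"
      using dim by (auto simp: Momenta_def V_def n_def fun_eq_iff intro: exI[of _ 0])
    then obtain b where b: "dec b = Part X n"
      using exists_Part X(1) by blast
    show "\<exists>p\<in>Ph Mod. X \<in> trace (dec p) \<and> Y \<in> trace (dec p)"
    proof (cases "X = Y")
      case True
      have "X \<in> trace (dec b)"
        unfolding b by (rule trace_Part order_refl)+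
      then show ?thesis
        using b n True by (intro bexI[of _ b]) auto
    next
      case False
      then have "(\<lambda>i. Y i - X i) \<in> Momenta ftl"
        using null V_minus[OF Y(1) X(1)] by (simp add: Momenta_def fun_eq_iff) metis
      then obtain c where c: "dec c = Part X (\<lambda>i. Y i - X i)"
        using exists_Part X(1) by blast
      have "X \<in> trace (dec c)" "Y \<in> trace (dec c)"
        using trace_Part[of 1 X "\<lambda>i. Y i - X i"] by (simp_all add: c del: trace.simps)
      then show ?thesis
        using c null by (intro bexI[of _ c]) auto
    qed
  qed
qed

lemma AxLight_Mod: "AxLight d Mod"
proof -
  obtain k where k: "dec k = Obs proj"
    using exists_Obs proj_poincare by blast
  have "(\<exists>p\<in>Ph Mod. Wrel Mod k p xs \<and> Wrel Mod k p ys) \<longleftrightarrow>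
      space_dist d Mod xs ys = 1 \<otimes>\<^bsub>QR Mod\<^esub> time_dist Mod xs ys"
    if "xs \<in> points d Mod" "ys \<in> points d Mod" for xs ys
    using photon_through[OF k] that
    by (simp add: Mod_real(1-7) time_space_Mod del: real_sqrt_abs)
  moreover have "lessQ Mod \<zero>\<^bsub>QR Mod\<^esub> 1" "1 \<in> quants Mod" "k \<in> IOb Mod"
    using k by (simp_all add: Mod_real)
  ultimately show ?thesis
    unfolding AxLight_def by blast
qed

text \<open>For events simultaneous to an observer, the squared spatial distance is minus
  \<open>Q\<close> of their difference, which is invariant.\<close>

lemma AxSymD_Mod: "AxSymD d Mod"
  unfolding AxSymD_def
proof (intro conjI ballI impI)
  fix k h xs ys xs' ys'
  assume kh: "k \<in> IOb Mod" "h \<in> IOb Mod"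
    and pts: "xs \<in> points d Mod" "ys \<in> points d Mod" "xs' \<in> points d Mod" "ys' \<in> points d Mod"
    and ev: "xs ! 0 = ys ! 0 \<and> xs' ! 0 = ys' ! 0 \<and>
      same_event Mod k xs h xs' \<and> same_event Mod k ys h ys'"
  obtain f g where f: "dec k = Obs f" and g: "dec h = Obs g"
    using kh by auto
  obtain X where X: "X \<in> V" "coords xs = f X" using event[OF f] .
  obtain Y where Y: "Y \<in> V" "coords ys = f Y" using event[OF f] .
  obtain X' where X': "X' \<in> V" "coords xs' = g X'" using event[OF g] .
  obtain Y' where Y': "Y' \<in> V" "coords ys' = g Y'" using event[OF g] .
  have len: "length xs = d" "length ys = d" "length xs' = d" "length ys' = d"
    using pts by simp_all
  have "X = X'" "Y = Y'"
    using ev same_event_iff[OF f len(1) X g len(3) X'] same_event_iff[OF f len(2) Y g len(4) Y']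
    by blast+
  then have "Q (\<lambda>i. coords xs i - coords ys i) = Q (\<lambda>i. coords xs' i - coords ys' i)"
    using Q_event_diff[OF dec_Obs[OF f] X(2) Y(2)] Q_event_diff[OF dec_Obs[OF g] X'(2) Y'(2)]
    by simp
  then show "space_dist d Mod xs ys = space_dist d Mod xs' ys'"
    unfolding time_space_Mod using ev by simp
next
  fix k assume "k \<in> IOb Mod"
  then obtain f where f: "dec k = Obs f" by auto
  define e where "e = 1 # 1 # replicate (d - 2) (0 :: real)"
  have len: "length (replicate d (0 :: real)) = d" "length e = d"
    using dim by (simp_all add: e_def)
  have "(\<Sum>i\<in>{1..<d}. (e ! i)\<^sup>2) = (\<Sum>i\<in>{1..<2}. (e ! i)\<^sup>2)"
    using dim by (intro sum.mono_neutral_right) (auto simp: e_def nth_Cons')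
  then have "Q (\<lambda>i. coords (replicate d 0) i - coords e i) = 0"
    unfolding Q_coords_diff using dim by (simp add: e_def numeral_2_eq_2)
  then show "\<exists>p\<in>Ph Mod. Wrel Mod k p (replicate d \<zero>\<^bsub>QR Mod\<^esub>) \<and>
      Wrel Mod k p (\<one>\<^bsub>QR Mod\<^esub> # \<one>\<^bsub>QR Mod\<^esub> # replicate (d - 2) \<zero>\<^bsub>QR Mod\<^esub>)"
    using photon_through[OF f len] by (simp only: Mod_real e_def)
qed

section \<open>The Poincare group as a group of automorphisms\<close>

text \<open>\<open>T'\<close> is meant to be the inverse of \<open>T\<close>. Particles are moved by
  \<open>T\<close>, coordinate maps are precomposed with \<open>T'\<close>, so the two changes
  cancel in the coordinates assigned.\<close>

fun act :: "(vec \<Rightarrow> vec) \<Rightarrow> (vec \<Rightarrow> vec) \<Rightarrow> body \<Rightarrow> body" where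
  "act T T' (Obs f) = Obs (f \<circ> T')"
| "act T T' (Part x p) = Part (T x) (lin T p)"

lemma act_Bodies:
  assumes "T \<in> poincare" "T' \<in> poincare" "c \<in> Bodies ftl"
  shows "act T T' c \<in> Bodies ftl"
  using assms poincare_isometry[OF assms(1)]
  by (cases c) (auto simp: Bodies_def poincare_comp Momenta_lin isometryD(3))

lemma act_act:
  assumes "T \<in> poincare" "T' \<in> poincare" "T' \<circ> T = proj" "c \<in> Bodies ftl"
  shows "act T' T (act T T' c) = c"
proof (cases c)
  case (Obs f)
  then have "isometry f"
    using assms(4) poincare_isometry by (auto simp: Bodies_def)
  then show ?thesis
    using Obs assms(3) by (simp add: comp_assoc isometry_comp_proj)
next
  case (Part x p)
  then have "x \<in> V" "p \<in> V"
    using assms(4) by (auto simp: Bodies_def Momenta_def)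
  then show ?thesis
    using Part fun_cong[OF assms(3), of x]
      lin_inverse[OF poincare_isometry[OF assms(2)] assms(3), of p] by simp
qed

lemma trace_act:
  assumes "T \<in> poincare" "T' \<in> poincare" "T' \<circ> T = proj" "T \<circ> T' = proj" "c \<in> Bodies ftl"
  shows "trace (act T T' c) = T ` trace c"
proof (cases c)
  case (Obs f)
  have "{x \<in> V. \<forall>i>0. f (T' x) i = 0} = T ` {x \<in> V. \<forall>i>0. f x i = 0}"
  proof (intro equalityI subsetI)
    fix x assume "x \<in> {x \<in> V. \<forall>i>0. f (T' x) i = 0}"
    then have "T' x \<in> {x \<in> V. \<forall>i>0. f x i = 0}" "x = T (T' x)"
      using fun_cong[OF assms(4), of x] isometryD(3)[OF poincare_isometry[OF assms(2)]] by simp_all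
    then show "x \<in> T ` {x \<in> V. \<forall>i>0. f x i = 0}"
      by (metis (no_types, lifting) image_eqI)
  next
    fix y assume "y \<in> T ` {x \<in> V. \<forall>i>0. f x i = 0}"
    then obtain x where x: "y = T x" "x \<in> V" "\<forall>i>0. f x i = 0"
      by blast
    then have "T' y = x"
      using fun_cong[OF assms(3), of x] by simp
    then show "y \<in> {x \<in> V. \<forall>i>0. f (T' x) i = 0}"
      using x isometryD(3)[OF poincare_isometry[OF assms(1)]] by simp
  qed
  then show ?thesis
    by (simp add: Obs)
next
  case (Part x p)
  show ?thesis
    unfolding Part act.simps trace.simps
    using isometryD(1)[OF poincare_isometry[OF assms(1)], of x _ p, symmetric]
    by (auto simp: image_iff)
qed

lemma SPRplus_Mod:
  assumes "freeB \<phi> \<subseteq> {u}"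
  shows "SPRplus_inst \<phi> u Mod"
proof (rule SPRplus_inst_by_automorphism[OF assms])
  fix k h
  assume "k \<in> IOb Mod" "h \<in> IOb Mod"
  then obtain f g where fg: "dec k = Obs f" "dec h = Obs g"
    by auto
  obtain f' where f': "f' \<in> poincare" "f \<circ> f' = proj" "f' \<circ> f = proj"
    using poincare_inverse[OF dec_Obs[OF fg(1)]] .
  obtain g' where g': "g' \<in> poincare" "g \<circ> g' = proj" "g' \<circ> g = proj"
    using poincare_inverse[OF dec_Obs[OF fg(2)]] .
  note iso = isometry_comp_proj[OF poincare_isometry]
  \<comment> \<open>\<open>T\<close> sends the event with given \<open>k\<close>-coordinates to the
    event with the same \<open>h\<close>-coordinates, which is what turns \<open>f\<close> into
    \<open>g\<close> under precomposition with \<open>T'\<close>.\<close>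
  define T T' where "T = g' \<circ> f" and "T' = f' \<circ> g"
  have T: "T \<in> poincare" "T' \<in> poincare"
    unfolding T_def T'_def
    using poincare_comp[OF g'(1) dec_Obs[OF fg(1)]] poincare_comp[OF f'(1) dec_Obs[OF fg(2)]]
    by simp_all
  have "T' \<circ> T = f' \<circ> ((g \<circ> g') \<circ> f)" "T \<circ> T' = g' \<circ> ((f \<circ> f') \<circ> g)"
    by (simp_all add: T_def T'_def comp_assoc)
  then have TT': "T' \<circ> T = proj" "T \<circ> T' = proj"
    using f' g' dec_Obs fg by (simp_all add: iso)
  have "f \<circ> T' = (f \<circ> f') \<circ> g"
    by (simp add: T'_def comp_assoc)
  then have kh: "f \<circ> T' = g"
    using f' dec_Obs fg by (simp add: iso)
  define \<sigma> where "\<sigma> b = inv_into UNIV dec (act T T' (dec b))" for b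
  define \<tau> where "\<tau> b = inv_into UNIV dec (act T' T (dec b))" for b
  have inv_dec: "inv_into UNIV dec (dec b) = b" "c \<in> Bodies ftl \<Longrightarrow> dec (inv_into UNIV dec c) = c" for b c
    using bij_dec by (auto simp: bij_betw_def f_inv_into_f)
  have dec_\<sigma>: "dec (\<sigma> b) = act T T' (dec b)" for b
    unfolding \<sigma>_def by (intro inv_dec act_Bodies T dec_in_Bodies)
  have dec_\<tau>: "dec (\<tau> b) = act T' T (dec b)" for b
    unfolding \<tau>_def by (intro inv_dec act_Bodies T dec_in_Bodies)
  have dec_eqI: "dec b = dec c \<Longrightarrow> b = c" for b c
    by (metis inv_dec(1))
  have lin_T': "lin (f \<circ> T') (lin T p) = lin f p" if "f \<in> poincare" "p \<in> V" for f p
    using that lin_inverse[OF poincare_isometry[OF T(2)] TT'(1), of p]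
    by (simp add: lin_comp poincare_isometry)
  show "\<exists>\<sigma>. \<sigma> k = h \<and>
        bij_betw \<sigma> (bodies Mod) (bodies Mod) \<and>
        (\<forall>b\<in>bodies Mod. \<sigma> b \<in> IOb Mod \<longleftrightarrow> b \<in> IOb Mod) \<and>
        (\<forall>b\<in>bodies Mod. \<sigma> b \<in> Ph Mod \<longleftrightarrow> b \<in> Ph Mod) \<and>
        (\<forall>k\<in>bodies Mod. \<forall>b\<in>bodies Mod. \<forall>x. Wrel Mod (\<sigma> k) (\<sigma> b) x \<longleftrightarrow> Wrel Mod k b x) \<and>
        (\<forall>k\<in>bodies Mod. \<forall>b\<in>bodies Mod. \<forall>q. Mrel Mod (\<sigma> k) (\<sigma> b) q \<longleftrightarrow> Mrel Mod k b q)"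
  proof (intro exI[of _ \<sigma>] conjI ballI allI)
    show "\<sigma> k = h"
      by (rule dec_eqI) (simp add: dec_\<sigma> fg kh)
    have "\<tau> (\<sigma> b) = b" "\<sigma> (\<tau> b) = b" for b
      by (rule dec_eqI, simp only: dec_\<sigma> dec_\<tau>, rule act_act, (rule T TT' dec_in_Bodies)+)+
    then show "bij_betw \<sigma> (bodies Mod) (bodies Mod)"
      by (intro bij_betw_byWitness[of _ \<tau>]) simp_all
    fix b
    show "\<sigma> b \<in> IOb Mod \<longleftrightarrow> b \<in> IOb Mod"
      by (cases "dec b") (simp_all add: dec_\<sigma>)
    show "\<sigma> b \<in> Ph Mod \<longleftrightarrow> b \<in> Ph Mod"
      by (cases "dec b") (simp_all add: dec_\<sigma> isometryD(4) poincare_isometry T)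
    fix k :: real
    show "Wrel Mod (\<sigma> k) (\<sigma> b) x \<longleftrightarrow> Wrel Mod k b x" for x
    proof (cases "dec k")
      case (Obs f)
      have "(f \<circ> T') ` trace (act T T' (dec b)) = (f \<circ> (T' \<circ> T)) ` trace (dec b)"
        by (simp only: trace_act[OF T TT' dec_in_Bodies] image_comp comp_assoc)
      also have "\<dots> = f ` trace (dec b)"
        by (simp only: TT' iso(1)[OF dec_Obs[OF Obs]])
      finally show ?thesis
        unfolding Wrel_Mod dec_\<sigma> Obs act.simps by simp
    qed (simp add: Wrel_Mod dec_\<sigma>)
    show "Mrel Mod (\<sigma> k) (\<sigma> b) q \<longleftrightarrow> Mrel Mod k b q" for q
    proof (cases "dec k")
      case (Obs f)
      show ?thesis
      proof (cases "dec b")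
        case (Part x p)
        then show ?thesis
          using lin_T'[OF dec_Obs[OF Obs] dec_Part(3)[OF Part]]
          by (simp add: Mrel_Mod dec_\<sigma> Obs)
      qed (simp add: Mrel_Mod dec_\<sigma>)
    qed (simp add: Mrel_Mod dec_\<sigma>)
  qed
qed simp

section \<open>World-lines, masses, velocities and speeds of particles\<close>

lemma trace_image: "trace (Part x p) = (\<lambda>t i. x i + t * p i) ` {0..}"
  by auto

lemma world_line_Part:
  assumes "dec k = Obs f" "dec b = Part x p"
  shows "world_line d Mod k b = (\<lambda>t. of_coords (\<lambda>i. f x i + t * lin f p i)) ` {0..}"
proof -
  note iso = poincare_isometry[OF dec_Obs[OF assms(1)]]
  have "f ` trace (dec b) = (\<lambda>t i. f x i + t * lin f p i) ` {0..}"
    unfolding assms(2) trace_image image_image isometryD(1)[OF iso] ..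
  then have W: "Wrel Mod k b xs \<longleftrightarrow> length xs = d \<and>
      coords xs \<in> (\<lambda>t i. f x i + t * lin f p i) ` {0..}" for xs
    unfolding Wrel_Mod assms(1) by simp
  have V: "(\<lambda>i. f x i + t * lin f p i) \<in> V" for t
    by (intro V_combine isometryD(3)[OF iso] lin_V[OF iso])
  have "coords xs = v \<longleftrightarrow> xs = of_coords v" if "length xs = d" "v \<in> V" for xs v
    using that by (metis coords_simps(2,4) proj_V(2))
  with V show ?thesis
    by (auto simp: world_line_def W image_iff)
qed

lemma lin_Part_nonzero:
  assumes "dec k = Obs f" "dec b = Part x p"
  obtains i where "i < d" "lin f p i \<noteq> 0"
proof -
  have "lin f p \<noteq> (\<lambda>_. 0)"
    using lin_eq_0_iff[OF dec_Obs[OF assms(1)] dec_Part(3)[OF assms(2)]] dec_Part(4)[OF assms(2)]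
    by simp
  then show ?thesis
    using that V_eqI[OF lin_V[OF poincare_isometry[OF dec_Obs[OF assms(1)]]] V_zero, of p] by metis
qed

lemma inertial_body_Part:
  assumes b: "dec b = Part x p"
  shows "inertial_body d Mod b"
  unfolding inertial_body_def
proof (intro ballI conjI)
  fix k assume "k \<in> IOb Mod"
  then obtain f where k: "dec k = Obs f" by auto
  obtain j where j: "j < d" "lin f p j \<noteq> 0"
    using lin_Part_nonzero[OF k b] .
  let ?L = "{map (\<lambda>i. of_coords (f x) ! i \<oplus>\<^bsub>QR Mod\<^esub> t \<otimes>\<^bsub>QR Mod\<^esub> of_coords (lin f p) ! i) [0..<d] | t.
      t \<in> quants Mod}"
  have "of_coords (lin f p) \<noteq> replicate d \<zero>\<^bsub>QR Mod\<^esub>"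
  proof
    assume "of_coords (lin f p) = replicate d \<zero>\<^bsub>QR Mod\<^esub>"
    then have "of_coords (lin f p) ! j = replicate d \<zero>\<^bsub>QR Mod\<^esub> ! j"
      by simp
    then show False
      using j by (simp add: Mod_real)
  qed
  then have "straight_line d Mod ?L"
    unfolding straight_line_def
    by (intro bexI[of _ "of_coords (f x)"] bexI[of _ "of_coords (lin f p)"] conjI refl) simp_all
  moreover have "of_coords (\<lambda>i. f x i + t * lin f p i) =
      map (\<lambda>i. of_coords (f x) ! i \<oplus>\<^bsub>QR Mod\<^esub> t \<otimes>\<^bsub>QR Mod\<^esub> of_coords (lin f p) ! i) [0..<d]" for t
    by (rule nth_equalityI) (simp_all add: Mod_real)
  then have "world_line d Mod k b \<subseteq> ?L"
    unfolding world_line_Part[OF k b] by auto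
  ultimately show "\<exists>L. straight_line d Mod L \<and> world_line d Mod k b \<subseteq> L"
    by blast
  define pt where "pt t = of_coords (\<lambda>i. f x i + t * lin f p i)" for t
  have "pt 0 ! j \<noteq> pt 1 ! j"
    using j by (simp add: pt_def)
  then have "pt 0 \<noteq> pt 1"
    by auto
  moreover have "pt 0 \<in> world_line d Mod k b" "pt 1 \<in> world_line d Mod k b"
    unfolding world_line_Part[OF k b] pt_def by (rule imageI, simp)+
  ultimately show "\<exists>x\<in>world_line d Mod k b. \<exists>y\<in>world_line d Mod k b. x \<noteq> y"
    by blast
qed

lemma mass_Part:
  assumes "dec k = Obs f" "dec b = Part x p"
  shows "mass Mod k b = Some \<bar>lin f p 0\<bar>"
  unfolding mass_def by (simp add: Mrel_Mod assms)

lemma Ip_iff: "Ip d Mod b \<longleftrightarrow> (\<exists>x p. dec b = Part x p)"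
proof
  assume Ip: "Ip d Mod b"
  obtain k where k: "dec k = Obs proj"
    using exists_Obs proj_poincare by blast
  show "\<exists>x p. dec b = Part x p"
  proof (cases "dec b")
    case (Obs g)
    then have "mass Mod k b = None"
      by (simp add: mass_def Mrel_Mod Ex1_def)
    moreover have "k \<in> IOb Mod"
      using k by simp
    ultimately show ?thesis
      using Ip unfolding Ip_def by blast
  qed simp
next
  assume "\<exists>x p. dec b = Part x p"
  then show "Ip d Mod b"
    using inertial_body_Part mass_Part by (fastforce simp: Ip_def)
qed

lemma has_velocity_Part:
  assumes k: "dec k = Obs f" and b: "dec b = Part x p"
  shows "has_velocity d Mod k b \<longleftrightarrow> lin f p 0 \<noteq> 0"
proof -
  have "(\<exists>x\<in>world_line d Mod k b. \<exists>y\<in>world_line d Mod k b. x ! 0 \<noteq> y ! 0) \<longleftrightarrow>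
    (\<exists>s\<ge>0. \<exists>t\<ge>0. s * lin f p 0 \<noteq> t * lin f p 0)"
    unfolding world_line_Part[OF k b] by (simp add: Bex_def)
  also have "\<dots> \<longleftrightarrow> lin f p 0 \<noteq> 0"
    by simp (metis order_refl zero_le_one zero_neq_one)
  finally show ?thesis
    using inertial_body_Part[OF b] k by (simp add: has_velocity_def)
qed

lemma velocity_Part:
  assumes k: "dec k = Obs f" and b: "dec b = Part x p"
  shows "velocity d Mod k b = (if lin f p 0 = 0 then None
    else Some (map (\<lambda>i. lin f p i / lin f p 0) [1..<d]))"
proof (cases "lin f p 0 = 0")
  case False
  let ?P = "\<lambda>v. \<exists>x\<in>world_line d Mod k b. \<exists>y\<in>world_line d Mod k b. x ! 0 \<noteq> y ! 0 \<and>
    v = map (\<lambda>i. divQ Mod (x ! i \<ominus>\<^bsub>QR Mod\<^esub> y ! i) (x ! 0 \<ominus>\<^bsub>QR Mod\<^esub> y ! 0)) [1..<d]"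
  define pt where "pt t = of_coords (\<lambda>i. f x i + t * lin f p i)" for t
  have eq: "map (\<lambda>i. divQ Mod (pt s ! i \<ominus>\<^bsub>QR Mod\<^esub> pt t ! i) (pt s ! 0 \<ominus>\<^bsub>QR Mod\<^esub> pt t ! 0)) [1..<d] =
      map (\<lambda>i. lin f p i / lin f p 0) [1..<d]" if "pt s ! 0 \<noteq> pt t ! 0" for s t
  proof (rule map_cong[OF refl])
    fix i assume "i \<in> set [1..<d]"
    moreover have "s \<noteq> t"
      using that by auto
    moreover have "pt s ! 0 - pt t ! 0 = (s - t) * lin f p 0"
      by (simp add: pt_def algebra_simps)
    ultimately show "divQ Mod (pt s ! i \<ominus>\<^bsub>QR Mod\<^esub> pt t ! i) (pt s ! 0 \<ominus>\<^bsub>QR Mod\<^esub> pt t ! 0) =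
        lin f p i / lin f p 0"
      using False by (simp add: Mod_real pt_def field_simps)
  qed
  have wl: "world_line d Mod k b = pt ` {0..}"
    unfolding world_line_Part[OF k b] pt_def ..
  have "pt 0 ! 0 \<noteq> pt 1 ! 0"
    using False by (simp add: pt_def)
  then have "?P (map (\<lambda>i. lin f p i / lin f p 0) [1..<d])"
    unfolding wl by - (rule bexI[of _ "pt 0"], rule bexI[of _ "pt 1"], simp_all add: eq del: map_eq_conv One_nat_def)
  moreover have "v = map (\<lambda>i. lin f p i / lin f p 0) [1..<d]" if "?P v" for v
    using that unfolding wl by (auto simp del: map_eq_conv One_nat_def simp: eq)
  ultimately have "(THE v. ?P v) = map (\<lambda>i. lin f p i / lin f p 0) [1..<d]"
    by (rule the_equality)
  then show ?thesis
    using False has_velocity_Part[OF k b] by (simp add: velocity_def)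
qed (use has_velocity_Part[OF k b] in \<open>simp add: velocity_def\<close>)

text \<open>This is the relation \<open>Q p = m\<^sup>2 * (1 - v\<^sup>2)\<close> between mass and
  speed. Since \<open>lin f\<close> preserves \<open>Q\<close>, its left side is the same for all
  observers, which is what \<open>AxSpd\<close> rests on.\<close>

lemma speed_Part:
  assumes k: "dec k = Obs f" and b: "dec b = Part x p"
  shows "speed d Mod k b = (if lin f p 0 = 0 then None
    else Some (sqrt (1 - Q p / (lin f p 0)\<^sup>2)))"
proof (cases "lin f p 0 = 0")
  case False
  let ?P = "\<lambda>s. \<exists>x\<in>world_line d Mod k b. \<exists>y\<in>world_line d Mod k b. x ! 0 \<noteq> y ! 0 \<and>
    s = divQ Mod (space_dist d Mod x y) (time_dist Mod x y)"
  define pt where "pt t = of_coords (\<lambda>i. f x i + t * lin f p i)" for t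
  have eq: "divQ Mod (space_dist d Mod (pt s) (pt t)) (time_dist Mod (pt s) (pt t)) =
      sqrt (1 - Q p / (lin f p 0)\<^sup>2)" if "pt s ! 0 \<noteq> pt t ! 0" for s t
  proof -
    have "s \<noteq> t"
      using that by auto
    have 0: "pt s ! 0 - pt t ! 0 = (s - t) * lin f p 0"
      by (simp add: pt_def algebra_simps)
    have "Q (\<lambda>i. coords (pt s) i - coords (pt t) i) = Q (\<lambda>i. (s - t) * proj (lin f p) i)"
      by (intro arg_cong2[of _ _ _ _ inner] ext) (simp_all add: pt_def proj_def algebra_simps)
    also have "\<dots> = (s - t)\<^sup>2 * Q p"
      by (simp add: Q_scale isometryD(4) poincare_isometry[OF dec_Obs[OF k]])
    finally have "divQ Mod (space_dist d Mod (pt s) (pt t)) (time_dist Mod (pt s) (pt t)) =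
        sqrt (((s - t) * lin f p 0)\<^sup>2 - (s - t)\<^sup>2 * Q p) / sqrt (((s - t) * lin f p 0)\<^sup>2)"
      using \<open>s \<noteq> t\<close> False unfolding time_space_Mod 0 by (subst Mod_real) simp_all
    also have "\<dots> = sqrt ((((s - t) * lin f p 0)\<^sup>2 - (s - t)\<^sup>2 * Q p) / ((s - t) * lin f p 0)\<^sup>2)"
      by (rule real_sqrt_divide[symmetric])
    also have "(((s - t) * lin f p 0)\<^sup>2 - (s - t)\<^sup>2 * Q p) / ((s - t) * lin f p 0)\<^sup>2 =
        1 - Q p / (lin f p 0)\<^sup>2"
      using \<open>s \<noteq> t\<close> False by (simp add: power_mult_distrib diff_divide_distrib)
    finally show ?thesis .
  qed
  have wl: "world_line d Mod k b = pt ` {0..}"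
    unfolding world_line_Part[OF k b] pt_def ..
  have "pt 0 ! 0 \<noteq> pt 1 ! 0"
    using False by (simp add: pt_def)
  then have "?P (sqrt (1 - Q p / (lin f p 0)\<^sup>2))"
    unfolding wl by - (rule bexI[of _ "pt 0"], rule bexI[of _ "pt 1"], simp_all add: eq)
  moreover have "v = sqrt (1 - Q p / (lin f p 0)\<^sup>2)" if "?P v" for v
    using that unfolding wl by (auto simp: eq)
  ultimately have "(THE s. ?P s) = sqrt (1 - Q p / (lin f p 0)\<^sup>2)"
    by (rule the_equality)
  then show ?thesis
    using False has_velocity_Part[OF k b] by (simp add: speed_def)
qed (use has_velocity_Part[OF k b] in \<open>simp add: speed_def\<close>)

end

section \<open>Collisions as vanishing of the total four-momentum\<close>

text \<open>Negative \<open>a i\<close> mark incoming bodies; moving their terms to the other side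
  removes the absolute values and merges both sums. The choice \<open>c = 1\<close> gives
  conservation of mass, and a velocity component as \<open>c\<close> gives conservation of
  momentum.\<close>

lemma balance_iff:
  fixes a c :: "nat \<Rightarrow> real"
  assumes "\<And>i. i < n \<Longrightarrow> a i \<noteq> 0"
  shows "(\<Sum>i | i < n \<and> a i < 0. \<bar>a i\<bar> * c i) = (\<Sum>i | i < n \<and> 0 < a i. \<bar>a i\<bar> * c i) \<longleftrightarrow>
    (\<Sum>i<n. a i * c i) = 0"
proof -
  have *: "{..<n} = {i. i < n \<and> a i < 0} \<union> {i. i < n \<and> 0 < a i}"
  proof (rule Set.set_eqI)
    show "i \<in> {..<n} \<longleftrightarrow> i \<in> {i. i < n \<and> a i < 0} \<union> {i. i < n \<and> 0 < a i}" for i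
      using assms[of i] by auto
  qed
  have "(\<Sum>i<n. a i * c i) =
      (\<Sum>i | i < n \<and> a i < 0. a i * c i) + (\<Sum>i | i < n \<and> 0 < a i. a i * c i)"
    unfolding * by (rule sum.union_disjoint) auto
  moreover have "(\<Sum>i | i < n \<and> a i < 0. a i * c i) = - (\<Sum>i | i < n \<and> a i < 0. \<bar>a i\<bar> * c i)"
    unfolding sum_negf[symmetric] by (rule sum.cong) auto
  moreover have "(\<Sum>i | i < n \<and> 0 < a i. a i * c i) = (\<Sum>i | i < n \<and> 0 < a i. \<bar>a i\<bar> * c i)"
    by (rule sum.cong) auto
  ultimately show ?thesis
    by linarith
qed

context srdyn_model
begin

lemma Wrel_Part:
  assumes "dec k = Obs f" "dec b = Part x p"
  shows "Wrel Mod k b xs \<longleftrightarrow> (\<exists>t\<ge>0. xs = of_coords (\<lambda>i. f x i + t * lin f p i))"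
proof -
  have "Wrel Mod k b xs \<longleftrightarrow> xs \<in> world_line d Mod k b"
    by (auto simp: world_line_def Wrel_Mod)
  then show ?thesis
    unfolding world_line_Part[OF assms] by auto
qed

text \<open>The sign \<open>s\<close> treats both directions of time at once: \<open>s = 1\<close>
  gives \<open>out_at\<close> and \<open>s = -1\<close> gives \<open>in_at\<close>. Comparing an
  extremal parameter \<open>t\<close> with \<open>t + 1\<close> fixes the sign of the time
  component, and comparing it with 0 then forces \<open>t = 0\<close>.\<close>

lemma start_iff:
  assumes k: "dec k = Obs f" and b: "dec b = Part x p" and s: "s \<noteq> 0"
  shows "(Wrel Mod k b xs \<and> (\<forall>ys\<in>points d Mod. Wrel Mod k b ys \<longrightarrow> ys = xs \<or> s * xs ! 0 < s * ys ! 0))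
    \<longleftrightarrow> xs = of_coords (f x) \<and> 0 < s * lin f p 0"
proof -
  define pt where "pt t = of_coords (\<lambda>i. f x i + t * lin f p i)" for t
  have W: "Wrel Mod k b ys \<longleftrightarrow> (\<exists>t\<ge>0. ys = pt t)" for ys
    unfolding pt_def by (rule Wrel_Part[OF k b])
  have pt: "pt t \<in> points d Mod" "pt t ! 0 = f x 0 + t * lin f p 0" "pt 0 = of_coords (f x)" for t
    by (simp_all add: pt_def)
  obtain i where i: "i < d" "lin f p i \<noteq> 0"
    using lin_Part_nonzero[OF k b] .
  have inj: "pt r = pt t \<longleftrightarrow> r = t" for r t
  proof
    assume "pt r = pt t"
    then have "pt r ! i = pt t ! i"
      by (rule arg_cong)
    then show "r = t"
      using i by (simp add: pt_def)
  qed simp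
  have ball: "(\<forall>ys\<in>points d Mod. Wrel Mod k b ys \<longrightarrow> R ys) \<longleftrightarrow> (\<forall>r\<ge>0. R (pt r))" for R
    unfolding W using pt(1) by metis
  have "(Wrel Mod k b xs \<and> (\<forall>ys\<in>points d Mod. Wrel Mod k b ys \<longrightarrow> ys = xs \<or> s * xs ! 0 < s * ys ! 0))
    \<longleftrightarrow> (\<exists>t\<ge>0. xs = pt t \<and> (\<forall>r\<ge>0. r = t \<or> s * pt t ! 0 < s * pt r ! 0))"
    unfolding ball unfolding W by (auto simp: inj)
  also have "\<dots> \<longleftrightarrow> (\<exists>t\<ge>0. xs = pt t \<and> (\<forall>r\<ge>0. r = t \<or> 0 < (r - t) * (s * lin f p 0)))"
    by (simp add: pt(2) algebra_simps)
  also have "\<dots> \<longleftrightarrow> xs = pt 0 \<and> 0 < s * lin f p 0"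
  proof
    assume "\<exists>t\<ge>0. xs = pt t \<and> (\<forall>r\<ge>0. r = t \<or> 0 < (r - t) * (s * lin f p 0))"
    then obtain t where t: "0 \<le> t" "xs = pt t" "\<And>r. 0 \<le> r \<Longrightarrow> r = t \<or> 0 < (r - t) * (s * lin f p 0)"
      by blast
    have pos: "0 < s * lin f p 0"
      using t(3)[of "t + 1"] t(1) by simp
    have "t = 0"
    proof (rule ccontr)
      assume "t \<noteq> 0"
      then have "0 < (0 - t) * (s * lin f p 0)"
        using t(3)[of 0] by simp
      moreover have "0 \<le> t * (s * lin f p 0)"
        using t(1) pos by simp
      ultimately show False
        by simp
    qed
    then show "xs = pt 0 \<and> 0 < s * lin f p 0"
      using pos t(2) by simp
  next
    assume "xs = pt 0 \<and> 0 < s * lin f p 0"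
    then show "\<exists>t\<ge>0. xs = pt t \<and> (\<forall>r\<ge>0. r = t \<or> 0 < (r - t) * (s * lin f p 0))"
      by (intro exI[of _ 0]) (auto intro!: mult_pos_pos)
  qed
  finally show ?thesis
    by (simp only: pt(3))
qed

lemma out_at_iff:
  assumes k: "dec k = Obs f" and b: "dec b = Part x p"
  shows "out_at d Mod k b xs \<longleftrightarrow> xs = of_coords (f x) \<and> 0 < lin f p 0"
  using start_iff[OF k b, of 1 xs] Ip_iff[of b] b by (simp add: out_at_def Mod_real)

lemma in_at_iff:
  assumes k: "dec k = Obs f" and b: "dec b = Part x p"
  shows "in_at d Mod k b xs \<longleftrightarrow> xs = of_coords (f x) \<and> lin f p 0 < 0"
  using start_iff[OF k b, of "-1" xs] Ip_iff[of b] b by (simp add: in_at_def Mod_real)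

lemma of_coords_event_iff:
  assumes "f \<in> poincare" "x \<in> V" "length xs = d" "X \<in> V" "coords xs = f X"
  shows "xs = of_coords (f x) \<longleftrightarrow> x = X"
proof -
  have "xs = of_coords (f x) \<longleftrightarrow> coords xs = f x"
    using assms(3) isometryD(3)[OF poincare_isometry[OF assms(1)], of x]
    by (metis coords_simps(2,4) proj_V(2))
  then show ?thesis
    unfolding assms(5) using poincare_inj[OF assms(1,4,2)] by metis
qed

lemma in_or_out_at_iff:
  assumes k: "dec k = Obs f" and xs: "length xs = d" "X \<in> V" "coords xs = f X"
  shows "in_at d Mod k b xs \<or> out_at d Mod k b xs \<longleftrightarrow> (\<exists>p. dec b = Part X p \<and> lin f p 0 \<noteq> 0)"
proof (cases "dec b")
  case (Part x p)
  show ?thesis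
    unfolding in_at_iff[OF k Part] out_at_iff[OF k Part]
      of_coords_event_iff[OF dec_Obs[OF k] dec_Part(1)[OF Part] xs]
    by (auto simp: Part neq_iff)
next
  case (Obs g)
  then show ?thesis
    by (simp add: in_at_def out_at_def Ip_iff)
qed

text \<open>The right-hand side depends on the observer only through the finiteness of the speeds.\<close>

lemma coll_iff:
  assumes k: "dec k = Obs f"
  shows "coll d Mod k bs \<longleftrightarrow>
    (\<exists>X\<in>V. \<exists>p. (\<forall>i<length bs. dec (bs ! i) = Part X (p i) \<and> lin f (p i) 0 \<noteq> 0) \<and>
       (\<lambda>j. \<Sum>i<length bs. p i j) = (\<lambda>_. 0))"
proof -
  note iso = poincare_isometry[OF dec_Obs[OF k]]
  define conserved where "conserved xs \<longleftrightarrow>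
     (let I = {i. i < length bs \<and> in_at d Mod k (bs ! i) xs};
          J = {i. i < length bs \<and> out_at d Mod k (bs ! i) xs}
      in \<exists>m v. (\<forall>i<length bs. mass Mod k (bs ! i) = Some (m i) \<and>
                  velocity d Mod k (bs ! i) = Some (v i)) \<and>
           (\<Oplus>\<^bsub>QR Mod\<^esub>i\<in>I. m i) = (\<Oplus>\<^bsub>QR Mod\<^esub>i\<in>J. m i) \<and>
           (\<forall>j<d - 1. (\<Oplus>\<^bsub>QR Mod\<^esub>i\<in>I. m i \<otimes>\<^bsub>QR Mod\<^esub> v i ! j) = (\<Oplus>\<^bsub>QR Mod\<^esub>i\<in>J. m i \<otimes>\<^bsub>QR Mod\<^esub> v i ! j)))" for xs
  have coll: "coll d Mod k bs \<longleftrightarrow> (\<exists>xs\<in>points d Mod.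
      (\<forall>i<length bs. in_at d Mod k (bs ! i) xs \<or> out_at d Mod k (bs ! i) xs) \<and> conserved xs)"
    unfolding coll_def conserved_def ..
  have conserved_iff: "conserved xs \<longleftrightarrow> (\<lambda>j. \<Sum>i<length bs. p i j) = (\<lambda>_. 0)"
    if xs: "length xs = d" "X \<in> V" "coords xs = f X"
      and p: "\<And>i. i < length bs \<Longrightarrow> dec (bs ! i) = Part X (p i) \<and> lin f (p i) 0 \<noteq> 0" for xs X p
  proof -
    define L where "L i = lin f (p i)" for i
    have b: "dec (bs ! i) = Part X (p i)" and L0: "L i 0 \<noteq> 0" if "i < length bs" for i
      using p[OF that] by (simp_all add: L_def)
    have pV: "p i \<in> V" if "i < length bs" for i
      using dec_Part(3)[OF b[OF that]] .
    have "xs = of_coords (f X)"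
      using of_coords_event_iff[OF dec_Obs[OF k] xs(2) xs] by simp
    then have I: "{i. i < length bs \<and> in_at d Mod k (bs ! i) xs} = {i. i < length bs \<and> L i 0 < 0}"
      and J: "{i. i < length bs \<and> out_at d Mod k (bs ! i) xs} = {i. i < length bs \<and> 0 < L i 0}"
      by (simp_all add: in_at_iff[OF k b] out_at_iff[OF k b] L_def cong: conj_cong)
    define m v where "m i = \<bar>L i 0\<bar>" and "v i = map (\<lambda>j. L i j / L i 0) [1..<d]" for i
    have mv: "mass Mod k (bs ! i) = Some (m i)" "velocity d Mod k (bs ! i) = Some (v i)"
      if "i < length bs" for i
      using mass_Part[OF k b[OF that]] velocity_Part[OF k b[OF that]] L0[OF that]
      by (simp_all add: m_def v_def L_def)
    have sum_m: "(\<Sum>i | i < length bs \<and> L i 0 < 0. m i) = (\<Sum>i | i < length bs \<and> 0 < L i 0. m i) \<longleftrightarrow>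
        (\<Sum>i<length bs. L i 0) = 0"
      using balance_iff[OF L0, where c = "\<lambda>_. 1"] by (simp add: m_def)
    have sum_mv: "(\<Sum>i | i < length bs \<and> L i 0 < 0. m i * v i ! j) =
        (\<Sum>i | i < length bs \<and> 0 < L i 0. m i * v i ! j) \<longleftrightarrow> (\<Sum>i<length bs. L i (Suc j)) = 0"
      if "j < d - 1" for j
    proof -
      have "v i ! j = L i (Suc j) / L i 0" for i
        using that by (simp add: v_def)
      then have "(\<Sum>i<length bs. L i 0 * v i ! j) = (\<Sum>i<length bs. L i (Suc j))"
        using L0 by (intro sum.cong) simp_all
      then show ?thesis
        using balance_iff[OF L0, where c = "\<lambda>i. v i ! j"] by (simp add: m_def)
    qed
    have "conserved xs \<longleftrightarrow> (\<exists>m' v'. (\<forall>i<length bs. m i = m' i \<and> v i = v' i) \<and>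
        (\<Sum>i | i < length bs \<and> L i 0 < 0. m' i) = (\<Sum>i | i < length bs \<and> 0 < L i 0. m' i) \<and>
        (\<forall>j<d - 1. (\<Sum>i | i < length bs \<and> L i 0 < 0. m' i * v' i ! j) =
          (\<Sum>i | i < length bs \<and> 0 < L i 0. m' i * v' i ! j)))"
      unfolding conserved_def Let_def I J by (simp add: mv Mod_real cong: conj_cong)
    also have "\<dots> \<longleftrightarrow>
        (\<Sum>i | i < length bs \<and> L i 0 < 0. m i) = (\<Sum>i | i < length bs \<and> 0 < L i 0. m i) \<and>
        (\<forall>j<d - 1. (\<Sum>i | i < length bs \<and> L i 0 < 0. m i * v i ! j) =
          (\<Sum>i | i < length bs \<and> 0 < L i 0. m i * v i ! j))" (is "?A \<longleftrightarrow> ?B")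
    proof
      assume ?A
      then obtain m' v' where *: "\<forall>i<length bs. m i = m' i \<and> v i = v' i"
        and "(\<Sum>i | i < length bs \<and> L i 0 < 0. m' i) = (\<Sum>i | i < length bs \<and> 0 < L i 0. m' i)"
        "\<forall>j<d - 1. (\<Sum>i | i < length bs \<and> L i 0 < 0. m' i * v' i ! j) =
          (\<Sum>i | i < length bs \<and> 0 < L i 0. m' i * v' i ! j)"
        by blast
      moreover have "(\<Sum>i | i < length bs \<and> P i. m i) = (\<Sum>i | i < length bs \<and> P i. m' i)"
        "(\<Sum>i | i < length bs \<and> P i. m i * v i ! j) = (\<Sum>i | i < length bs \<and> P i. m' i * v' i ! j)"
        for P j
        using * by (auto intro: sum.cong)
      ultimately show ?B
        by simp
    qed blast
    \<comment> \<open>The mass equation is the time component of one vector equation. The shift to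
      \<open>Suc j\<close> arises because velocity lists start with the first spatial
      component.\<close>
    also have "\<dots> \<longleftrightarrow> (\<Sum>i<length bs. L i 0) = 0 \<and> (\<forall>j<d - 1. (\<Sum>i<length bs. L i (Suc j)) = 0)"
      by (simp add: sum_m sum_mv)
    also have "\<dots> \<longleftrightarrow> (\<forall>j<d. (\<Sum>i<length bs. L i j) = 0)"
      using dim_pos by (cases d) (auto simp: less_Suc_eq_0_disj)
    also have "\<dots> \<longleftrightarrow> (\<lambda>j. \<Sum>i<length bs. L i j) = (\<lambda>_. 0)"
    proof
      assume *: "\<forall>j<d. (\<Sum>i<length bs. L i j) = 0"
      have "L i \<in> V" for i
        unfolding L_def by (rule lin_V[OF iso])
      then have "(\<lambda>j. \<Sum>i<length bs. L i j) \<in> V"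
        by (simp add: V_def)
      then show "(\<lambda>j. \<Sum>i<length bs. L i j) = (\<lambda>_. 0)"
        by (rule V_eqI) (use * in simp_all)
    qed metis
    \<comment> \<open>Here the observer disappears: linearity takes \<open>lin f\<close> out of the
      sum, and its injectivity on \<open>V\<close> removes it.\<close>
    also have "(\<lambda>j. \<Sum>i<length bs. L i j) = lin f (\<lambda>j. \<Sum>i<length bs. p i j)"
      unfolding L_def by (rule lin_sum[OF iso, symmetric]) simp
    also have "\<dots> = (\<lambda>_. 0) \<longleftrightarrow> (\<lambda>j. \<Sum>i<length bs. p i j) = (\<lambda>_. 0)"
      using pV by (intro lin_eq_0_iff dec_Obs[OF k]) (simp add: V_def)
    finally show ?thesis .
  qed
  show ?thesis
  proof
    assume "coll d Mod k bs"
    then obtain xs where xs: "length xs = d" "conserved xs"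
      and at: "\<And>i. i < length bs \<Longrightarrow> in_at d Mod k (bs ! i) xs \<or> out_at d Mod k (bs ! i) xs"
      unfolding coll by auto
    obtain X where X: "X \<in> V" "coords xs = f X"
      using event[OF k] .
    have "\<forall>i. \<exists>p. i < length bs \<longrightarrow> dec (bs ! i) = Part X p \<and> lin f p 0 \<noteq> 0"
      using at in_or_out_at_iff[OF k xs(1) X] by blast
    then obtain p where p: "\<And>i. i < length bs \<Longrightarrow> dec (bs ! i) = Part X (p i) \<and> lin f (p i) 0 \<noteq> 0"
      by metis
    show "\<exists>X\<in>V. \<exists>p. (\<forall>i<length bs. dec (bs ! i) = Part X (p i) \<and> lin f (p i) 0 \<noteq> 0) \<and>
       (\<lambda>j. \<Sum>i<length bs. p i j) = (\<lambda>_. 0)"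
      using X(1) p conserved_iff[OF xs(1) X p] xs(2) by blast
  next
    assume "\<exists>X\<in>V. \<exists>p. (\<forall>i<length bs. dec (bs ! i) = Part X (p i) \<and> lin f (p i) 0 \<noteq> 0) \<and>
       (\<lambda>j. \<Sum>i<length bs. p i j) = (\<lambda>_. 0)"
    then obtain X p where X: "X \<in> V"
      and p: "\<And>i. i < length bs \<Longrightarrow> dec (bs ! i) = Part X (p i) \<and> lin f (p i) 0 \<noteq> 0"
      and sum: "(\<lambda>j. \<Sum>i<length bs. p i j) = (\<lambda>_. 0)"
      by blast
    have "proj (f X) = f X"
      by (rule proj_V(2), rule isometryD(3), rule iso)
    then have xs: "length (of_coords (f X)) = d" "coords (of_coords (f X)) = f X"
      by simp_all
    have "conserved (of_coords (f X))"
      using conserved_iff[OF xs(1) X xs(2) p] sum by blast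
    moreover have "in_at d Mod k (bs ! i) (of_coords (f X)) \<or> out_at d Mod k (bs ! i) (of_coords (f X))"
      if "i < length bs" for i
      using in_or_out_at_iff[OF k xs(1) X xs(2)] p[OF that] by blast
    ultimately show "coll d Mod k bs"
      unfolding coll using xs(1) by (intro bexI[of _ "of_coords (f X)"]) simp_all
  qed
qed

section \<open>The axioms of dynamics\<close>

lemma finite_speed_Part:
  assumes "dec k = Obs f" "dec b = Part x p"
  shows "finite_speed d Mod k b \<longleftrightarrow> lin f p 0 \<noteq> 0"
  by (simp add: speed_Part[OF assms])

lemma velocity_scale:
  assumes k: "dec k = Obs f" and b: "dec b = Part x p" "dec c = Part y (\<lambda>i. s * p i)" and "s \<noteq> 0"
  shows "velocity d Mod k c = velocity d Mod k b"
proof -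
  have "lin f (\<lambda>i. s * p i) = (\<lambda>i. s * lin f p i)"
    by (rule lin_scale[OF poincare_isometry[OF dec_Obs[OF k]]])
  then show ?thesis
    using \<open>s \<noteq> 0\<close> by (simp add: velocity_Part[OF k b(1)] velocity_Part[OF k b(2)])
qed

text \<open>Reversing the four-momentum turns an outgoing particle into an incoming one without changing
  its mass and velocity.\<close>

lemma exists_directed_copy:
  assumes k: "dec k = Obs f" and a: "dec a = Part x p" and fin: "lin f p 0 \<noteq> 0" and X: "X \<in> V"
    and \<epsilon>: "\<bar>\<epsilon>\<bar> = 1"
  obtains b q where "dec b = Part X q" "lin f q 0 = \<epsilon> * \<bar>lin f p 0\<bar>"
    "mass Mod k b = mass Mod k a" "velocity d Mod k b = velocity d Mod k a"
proof -
  define s where "s = \<epsilon> * sgn (lin f p 0)"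
  have s: "\<bar>s\<bar> = 1" "s \<noteq> 0"
    using fin \<epsilon> by (auto simp: s_def abs_mult abs_sgn_eq sgn_eq_0_iff)
  obtain b where b: "dec b = Part X (\<lambda>i. s * p i)"
    using exists_Part[OF X Momenta_scale[OF dec_Part(2)[OF a] s(2)]] by blast
  have lin: "lin f (\<lambda>i. s * p i) = (\<lambda>i. s * lin f p i)"
    by (rule lin_scale[OF poincare_isometry[OF dec_Obs[OF k]]])
  show ?thesis
  proof (rule that[OF b])
    show "lin f (\<lambda>i. s * p i) 0 = \<epsilon> * \<bar>lin f p 0\<bar>"
      unfolding lin by (simp add: s_def abs_sgn mult.commute)
    show "mass Mod k b = mass Mod k a"
      unfolding mass_Part[OF k b] mass_Part[OF k a] lin using s(1) by (simp add: abs_mult)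
    show "velocity d Mod k b = velocity d Mod k a"
      by (rule velocity_scale[OF k a b s(2)])
  qed
qed

lemma AxColl_Mod: "AxColl d n Mod"
  unfolding AxColl_def
proof (intro ballI allI impI)
  fix k h bs
  assume "k \<in> IOb Mod" "h \<in> IOb Mod"
    and bs: "length bs = n \<and> set bs \<subseteq> bodies Mod \<and>
      (\<forall>i<n. finite_speed d Mod h (bs ! i)) \<and> coll d Mod k bs"
  then obtain f g where k: "dec k = Obs f" and h: "dec h = Obs g"
    by auto
  obtain X p where X: "X \<in> V" "\<And>i. i < n \<Longrightarrow> dec (bs ! i) = Part X (p i)"
    and sum: "(\<lambda>j. \<Sum>i<n. p i j) = (\<lambda>_. 0)"
    using bs coll_iff[OF k, of bs] by blast
  have "dec (bs ! i) = Part X (p i) \<and> lin g (p i) 0 \<noteq> 0" if "i < n" for i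
    using X(2)[OF that] finite_speed_Part[OF h X(2)[OF that]] bs that by blast
  then show "coll d Mod h bs"
    unfolding coll_iff[OF h] using X(1) sum bs by blast
qed

text \<open>For causal vectors this is convexity of the future cone, obtained from the Euclidean
  triangle inequality for the spatial parts. Positive time components also keep the sum from
  vanishing, the only concern when all vectors are allowed.\<close>

lemma Momenta_sum:
  assumes "p \<in> Momenta ftl" "q \<in> Momenta ftl" "0 < p 0" "0 < q 0"
  shows "(\<lambda>i. p i + 1 * q i) \<in> Momenta ftl"
proof -
  have "0 < p 0 + q 0"
    using assms by simp
  then have "(\<lambda>i. p i + 1 * q i) \<noteq> (\<lambda>_. 0)"
    by (auto dest: fun_cong[of _ _ 0])
  moreover have "(\<lambda>i. p i + 1 * q i) \<in> V"
    using assms by (intro V_combine) (auto simp: Momenta_def)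
  moreover have "0 \<le> Q (\<lambda>i. p i + 1 * q i)" if "\<not> ftl"
  proof -
    have norm: "L2_set r {1..<d} \<le> r 0" if "r \<in> Momenta ftl" "0 < r 0" for r
    proof -
      have "L2_set r {1..<d} \<le> sqrt ((r 0)\<^sup>2)"
        unfolding L2_set_def using that \<open>\<not> ftl\<close>
        by (intro real_sqrt_le_mono) (simp add: Momenta_def inner_def power2_eq_square)
      then show ?thesis
        using that by simp
    qed
    have "L2_set (\<lambda>i. p i + q i) {1..<d} \<le> p 0 + q 0"
      using L2_set_triangle_ineq[of p q "{1..<d}"] norm[of p] norm[of q] assms by simp
    then have "(L2_set (\<lambda>i. p i + q i) {1..<d})\<^sup>2 \<le> (p 0 + q 0)\<^sup>2"
      by (intro power_mono) simp_all
    then show ?thesis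
      by (simp add: L2_set_def sum_nonneg inner_def power2_eq_square)
  qed
  ultimately show ?thesis
    by (auto simp: Momenta_def)
qed

lemma AxAllInecoll_Mod: "AxAllInecoll d Mod"
  unfolding AxAllInecoll_def
proof (intro ballI impI)
  fix k a b xs
  assume "k \<in> IOb Mod" "xs \<in> points d Mod"
    and ab: "Ip d Mod a \<and> Ip d Mod b \<and> finite_speed d Mod k a \<and> finite_speed d Mod k b \<and>
      (\<exists>p q. mass Mod k a = Some p \<and> mass Mod k b = Some q \<and> p \<oplus>\<^bsub>QR Mod\<^esub> q \<noteq> \<zero>\<^bsub>QR Mod\<^esub>)"
  then obtain f where k: "dec k = Obs f" and xs: "length xs = d"
    by auto
  note iso = poincare_isometry[OF dec_Obs[OF k]]
  obtain g where g: "g \<in> poincare" "f \<circ> g = proj" "g \<circ> f = proj"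
    using poincare_inverse[OF dec_Obs[OF k]] .
  obtain X where X: "X \<in> V" "coords xs = f X"
    using event[OF k] .
  obtain xa pa xb pb where a: "dec a = Part xa pa" and b: "dec b = Part xb pb"
    using ab Ip_iff by blast
  have fin: "lin f pa 0 \<noteq> 0" "lin f pb 0 \<noteq> 0"
    using ab finite_speed_Part[OF k a] finite_speed_Part[OF k b] by blast+
  obtain a' qa where a': "dec a' = Part X qa" "lin f qa 0 = -1 * \<bar>lin f pa 0\<bar>"
    "mass Mod k a' = mass Mod k a" "velocity d Mod k a' = velocity d Mod k a"
    by (rule exists_directed_copy[OF k a fin(1) X(1), of "-1"]) simp_all
  obtain b' qb where b': "dec b' = Part X qb" "lin f qb 0 = -1 * \<bar>lin f pb 0\<bar>"
    "mass Mod k b' = mass Mod k b" "velocity d Mod k b' = velocity d Mod k b"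
    by (rule exists_directed_copy[OF k b fin(2) X(1), of "-1"]) simp_all
  \<comment> \<open>Both colliding copies have negative time component for \<open>k\<close>; the
    product carries minus their sum, so that it is outgoing and the three momenta cancel.\<close>
  define qc where "qc = (\<lambda>i. -1 * qa i + 1 * (-1 * qb i))"
  have lin_qc: "lin f qc = (\<lambda>i. -1 * lin f qa i + 1 * (-1 * lin f qb i))"
    unfolding qc_def by (simp only: lin_combine[OF iso] lin_scale[OF iso])
  have mom: "(\<lambda>i. -1 * lin f q i) \<in> Momenta ftl" if "q \<in> Momenta ftl" for q
    by (rule Momenta_scale[OF Momenta_lin[OF that dec_Obs[OF k]]]) simp
  have "lin f qc \<in> Momenta ftl"
    unfolding lin_qc using a'(2) b'(2) fin
    by (intro Momenta_sum mom dec_Part(2)[OF a'(1)] dec_Part(2)[OF b'(1)]) simp_all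
  \<comment> \<open>Time orientation refers to \<open>k\<close>, so the sum was formed in the
    coordinates of \<open>k\<close> and has to be carried back to the reference frame.\<close>
  then have "lin g (lin f qc) \<in> Momenta ftl"
    by (rule Momenta_lin[OF _ g(1)])
  moreover have "qc \<in> V"
    using dec_Part(3)[OF a'(1)] dec_Part(3)[OF b'(1)] by (simp add: qc_def V_def)
  ultimately have "qc \<in> Momenta ftl"
    using lin_inverse[OF poincare_isometry[OF g(1)] g(3), of qc] by simp
  then obtain c where c: "dec c = Part X qc"
    using exists_Part[OF X(1)] by blast
  have c0: "0 < lin f qc 0"
    unfolding lin_qc using a'(2) b'(2) fin by simp
  have at: "xs = of_coords (f X)"
    using of_coords_event_iff[OF dec_Obs[OF k] X(1) xs X] by simp
  have "coll d Mod k [a', b', c]"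
    unfolding coll_iff[OF k]
  proof (intro bexI[of _ X] exI[of _ "\<lambda>i. [qa, qb, qc] ! i"] conjI allI impI)
    fix i assume "i < length [a', b', c]"
    then consider "i = 0" | "i = 1" | "i = 2"
      by fastforce
    then show "dec ([a', b', c] ! i) = Part X ([qa, qb, qc] ! i)" "lin f ([qa, qb, qc] ! i) 0 \<noteq> 0"
      using a'(1,2) b'(1,2) c c0 fin by (cases; simp)+
  next
    show "(\<lambda>j. \<Sum>i<length [a', b', c]. ([qa, qb, qc] ! i) j) = (\<lambda>_. 0)"
      by (simp add: qc_def)
  qed (fact X(1))
  moreover have "in_at d Mod k a' xs" "in_at d Mod k b' xs" "out_at d Mod k c xs"
    using in_at_iff[OF k a'(1)] in_at_iff[OF k b'(1)] out_at_iff[OF k c] a'(2) b'(2) fin c0 at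
    by simp_all
  ultimately have "inecoll d Mod xs k a' b'"
    by (auto simp: inecoll_def)
  moreover have "eqd (mass Mod k a') (mass Mod k a)" "eqd (mass Mod k b') (mass Mod k b)"
    unfolding a'(3) b'(3) mass_Part[OF k a] mass_Part[OF k b] by (simp_all add: eqd_def)
  moreover have "eqd (velocity d Mod k a') (velocity d Mod k a)"
    "eqd (velocity d Mod k b') (velocity d Mod k b)"
    unfolding a'(4) b'(4) velocity_Part[OF k a] velocity_Part[OF k b]
    using fin by (simp_all add: eqd_def)
  ultimately show "\<exists>a'\<in>bodies Mod. \<exists>b'\<in>bodies Mod. inecoll d Mod xs k a' b' \<and>
      eqd (mass Mod k a') (mass Mod k a) \<and> eqd (mass Mod k b') (mass Mod k b) \<and>
      eqd (velocity d Mod k a') (velocity d Mod k a) \<and>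
      eqd (velocity d Mod k b') (velocity d Mod k b)"
    by (intro bexI[of _ a'] bexI[of _ b']) simp_all
qed

lemma AxSpd_Mod: "AxSpd d Mod"
  unfolding AxSpd_def
proof (intro ballI impI)
  fix k h b
  assume "k \<in> IOb Mod" "h \<in> IOb Mod" and b: "Ip d Mod b \<and>
    (\<exists>s. speed d Mod k b = Some s \<and> speed d Mod h b = Some s \<and> lessQ Mod s \<one>\<^bsub>QR Mod\<^esub>)"
  then obtain f g where k: "dec k = Obs f" and h: "dec h = Obs g"
    by auto
  obtain x p where p: "dec b = Part x p"
    using b Ip_iff by blast
  let ?a = "lin f p 0" and ?c = "lin g p 0"
  have nz: "?a \<noteq> 0" "?c \<noteq> 0"
    using b by (auto simp: speed_Part[OF k p] speed_Part[OF h p] split: if_splits)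
  then have eq: "sqrt (1 - Q p / ?a\<^sup>2) = sqrt (1 - Q p / ?c\<^sup>2)" and lt: "sqrt (1 - Q p / ?a\<^sup>2) < 1"
    using b by (auto simp: speed_Part[OF k p] speed_Part[OF h p] Mod_real(5,6))
  \<comment> \<open>A speed strictly below 1 excludes null momenta, so \<open>Q p\<close> can be
    cancelled to compare the time components.\<close>
  then have "Q p / ?a\<^sup>2 = Q p / ?c\<^sup>2" "Q p \<noteq> 0"
    by auto
  then have "?a\<^sup>2 = ?c\<^sup>2"
    using nz by (simp add: frac_eq_eq)
  then have "\<bar>?a\<bar> = \<bar>?c\<bar>"
    by (simp add: power2_eq_iff abs_eq_iff)
  then show "eqd (mass Mod k b) (mass Mod h b)"
    by (simp add: mass_Part[OF k p] mass_Part[OF h p] eqd_def)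
qed

text \<open>Mass and velocity for one observer fix the four-momentum up to the sign
  \<open>s\<close>. The vectors then agree up to this sign for every observer, and masses ignore
  it.\<close>

lemma AxMass_Mod: "AxMass d Mod"
  unfolding AxMass_def
proof (intro ballI impI)
  fix k h a b
  assume "k \<in> IOb Mod" "h \<in> IOb Mod" and ab: "Ip d Mod a \<and> Ip d Mod b \<and>
    eqd (mass Mod k a) (mass Mod k b) \<and> eqd (velocity d Mod k a) (velocity d Mod k b)"
  then obtain f g where k: "dec k = Obs f" and h: "dec h = Obs g"
    by auto
  note iso = poincare_isometry[OF dec_Obs[OF k]]
  obtain x p y q where a: "dec a = Part x p" and b: "dec b = Part y q"
    using ab Ip_iff by blast
  have mass: "\<bar>lin f p 0\<bar> = \<bar>lin f q 0\<bar>"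
    using ab by (auto simp: mass_Part[OF k a] mass_Part[OF k b] eqd_def)
  have nz: "lin f p 0 \<noteq> 0" "lin f q 0 \<noteq> 0"
    and vel: "map (\<lambda>i. lin f p i / lin f p 0) [1..<d] = map (\<lambda>i. lin f q i / lin f q 0) [1..<d]"
    using ab by (auto simp: velocity_Part[OF k a] velocity_Part[OF k b] eqd_def split: if_splits)
  define s where "s = lin f q 0 / lin f p 0"
  have s: "\<bar>s\<bar> = 1"
    using mass nz by (simp add: s_def abs_divide)
  have "lin f q i - s * lin f p i = 0" if "i < d" for i
  proof (cases "i = 0")
    case False
    then have "lin f p i / lin f p 0 = lin f q i / lin f q 0"
      using vel that by (simp del: One_nat_def)
    then show ?thesis
      using nz by (simp add: s_def field_simps)
  qed (use nz in \<open>simp add: s_def\<close>)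
  moreover have "lin f (\<lambda>i. q i + (- s) * p i) = (\<lambda>i. lin f q i + (- s) * lin f p i)"
    by (rule lin_combine[OF iso])
  ultimately have "lin f (\<lambda>i. q i + (- s) * p i) = (\<lambda>_. 0)"
    by (intro V_eqI lin_V[OF iso] V_zero) simp
  moreover have "(\<lambda>i. q i + (- s) * p i) \<in> V"
    using dec_Part(3)[OF a] dec_Part(3)[OF b] by (intro V_combine)
  ultimately have "(\<lambda>i. q i + (- s) * p i) = (\<lambda>_. 0)"
    using lin_eq_0_iff[OF dec_Obs[OF k]] by blast
  then have "q = (\<lambda>i. s * p i)"
    by (simp add: fun_eq_iff)
  then have "lin g q = (\<lambda>i. s * lin g p i)"
    using lin_scale[OF poincare_isometry[OF dec_Obs[OF h]]] by simp
  then show "eqd (mass Mod h a) (mass Mod h b)"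
    using s by (simp add: mass_Part[OF h a] mass_Part[OF h b] eqd_def abs_mult)
qed

lemma AxAllColl_Mod: "AxAllColl d Mod"
  unfolding AxAllColl_def
proof (intro ballI impI)
  fix k a xs
  assume "k \<in> IOb Mod" "xs \<in> points d Mod" and Ip: "Ip d Mod a \<and> finite_speed d Mod k a"
  then obtain f where k: "dec k = Obs f" and xs: "length xs = d"
    by auto
  obtain X where X: "X \<in> V" "coords xs = f X"
    using event[OF k] .
  obtain x p where a: "dec a = Part x p"
    using Ip Ip_iff by blast
  have fin: "lin f p 0 \<noteq> 0"
    using Ip finite_speed_Part[OF k a] by blast
  have at: "xs = of_coords (f X)"
    using of_coords_event_iff[OF dec_Obs[OF k] X(1) xs X] by simp
  have same: "eqd (mass Mod k b) (mass Mod k a) \<and> eqd (velocity d Mod k b) (velocity d Mod k a)"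
    if "mass Mod k b = mass Mod k a" "velocity d Mod k b = velocity d Mod k a" for b
    unfolding that mass_Part[OF k a] velocity_Part[OF k a] using fin by (simp add: eqd_def)
  obtain b q where b: "dec b = Part X q" "lin f q 0 = 1 * \<bar>lin f p 0\<bar>"
    "mass Mod k b = mass Mod k a" "velocity d Mod k b = velocity d Mod k a"
    by (rule exists_directed_copy[OF k a fin X(1), of 1]) simp_all
  obtain c r where c: "dec c = Part X r" "lin f r 0 = -1 * \<bar>lin f p 0\<bar>"
    "mass Mod k c = mass Mod k a" "velocity d Mod k c = velocity d Mod k a"
    by (rule exists_directed_copy[OF k a fin X(1), of "-1"]) simp_all
  have "out_at d Mod k b xs" "in_at d Mod k c xs"
    using out_at_iff[OF k b(1)] in_at_iff[OF k c(1)] b(2) c(2) fin at by simp_all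
  then show "(\<exists>b\<in>bodies Mod. out_at d Mod k b xs \<and> eqd (mass Mod k b) (mass Mod k a) \<and>
      eqd (velocity d Mod k b) (velocity d Mod k a)) \<and>
    (\<exists>b\<in>bodies Mod. in_at d Mod k b xs \<and> eqd (mass Mod k b) (mass Mod k a) \<and>
      eqd (velocity d Mod k b) (velocity d Mod k a))"
    using same[OF b(3,4)] same[OF c(3,4)] by (metis Mod_simps(1) UNIV_I)
qed

lemma AxThExPlus_Mod: "AxThExPlus d Mod"
  unfolding AxThExPlus_def
proof (intro conjI ballI impI)
  fix k xs ys
  assume "k \<in> IOb Mod" "xs \<in> points d Mod" "ys \<in> points d Mod"
    and lt: "lessQ Mod (space_dist d Mod xs ys) (time_dist Mod xs ys)"
  then obtain f where k: "dec k = Obs f" and len: "length xs = d" "length ys = d"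
    by auto
  obtain X where X: "X \<in> V" "coords xs = f X" using event[OF k] .
  obtain Y where Y: "Y \<in> V" "coords ys = f Y" using event[OF k] .
  have "0 < Q (\<lambda>i. coords xs i - coords ys i)"
    using lt by (simp add: Mod_real(6) time_space_Mod del: real_sqrt_abs)
  then have "0 < Q (\<lambda>i. X i - Y i)"
    by (simp only: Q_event_diff[OF dec_Obs[OF k] X(2) Y(2)])
  then obtain g where g: "g \<in> poincare" "\<And>i. 0 < i \<Longrightarrow> g Y i = 0" "\<And>i. 0 < i \<Longrightarrow> g X i = 0"
    using exists_observer_through[OF Y(1) X(1)] by blast
  obtain h where h: "dec h = Obs g"
    using exists_Obs[OF g(1)] by blast
  have "X \<in> trace (dec h)" "Y \<in> trace (dec h)"
    using X(1) Y(1) g by (simp_all add: h)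
  then show "\<exists>h\<in>IOb Mod. Wrel Mod k h xs \<and> Wrel Mod k h ys"
    using Wrel_iff[OF k len(1) X] Wrel_iff[OF k len(2) Y] h by (intro bexI[of _ h]) simp_all
next
  fix k xs ys m
  assume "k \<in> IOb Mod" "xs \<in> points d Mod" "ys \<in> points d Mod"
    and le: "leQ Mod (space_dist d Mod xs ys) (time_dist Mod xs ys) \<and> lessQ Mod \<zero>\<^bsub>QR Mod\<^esub> m"
  then obtain f where k: "dec k = Obs f" and len: "length xs = d" "length ys = d"
    by auto
  note iso = poincare_isometry[OF dec_Obs[OF k]]
  obtain X where X: "X \<in> V" "coords xs = f X" using event[OF k] .
  obtain Y where Y: "Y \<in> V" "coords ys = f Y" using event[OF k] .
  have m: "0 < m"
    using le by (simp add: Mod_real)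
  have "\<exists>b p. dec b = Part X p \<and> \<bar>lin f p 0\<bar> = m \<and> Y \<in> trace (dec b)"
  proof (cases "X = Y")
    case True
    obtain g where g: "g \<in> poincare" "f \<circ> g = proj"
      using poincare_inverse[OF dec_Obs[OF k]] .
    \<comment> \<open>The four-momentum of a body of mass \<open>m\<close> at rest for
      \<open>k\<close>; coinciding points leave the direction free.\<close>
    define p where "p = lin g (\<lambda>i. m * unit_time i)"
    have "(\<lambda>i. m * unit_time i) \<in> Momenta ftl"
      using m by (intro Momenta_scale unit_time_Momenta) simp
    then have "p \<in> Momenta ftl"
      unfolding p_def by (rule Momenta_lin[OF _ g(1)])
    then obtain b where b: "dec b = Part X p"
      using exists_Part[OF X(1)] by blast
    have "lin f p 0 = m"
      using lin_inverse[OF iso g(2)] by (simp add: p_def proj_def unit_time_def)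
    moreover have "Y \<in> trace (dec b)"
      unfolding True b by (rule trace_Part order_refl)+
    ultimately show ?thesis
      using b m by (intro exI[of _ b] exI[of _ p]) (simp del: trace.simps)
  next
    case False
    define v where "v = (\<lambda>i. Y i - X i)"
    have lin_v: "lin f v = (\<lambda>i. coords ys i - coords xs i)"
      unfolding v_def X(2) Y(2) by (rule lin_diff[OF iso])
    have "v \<in> V"
      unfolding v_def by (rule V_minus[OF Y(1) X(1)])
    have "v \<noteq> (\<lambda>_. 0)"
      using False by (simp add: v_def fun_eq_iff) metis
    have "0 \<le> Q (\<lambda>i. coords xs i - coords ys i)"
      using le by (simp add: Mod_real(7) time_space_Mod del: real_sqrt_abs)
    also have "\<dots> = Q (lin f v)"
      using Q_scale[of "-1" "lin f v"] by (simp add: lin_v)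
    finally have Q: "0 \<le> Q (lin f v)" "0 \<le> Q v"
      by (simp_all add: isometryD(4)[OF iso])
    \<comment> \<open>A vector with nonnegative \<open>Q\<close> and zero time component has no
      spatial part either, so it would be zero.\<close>
    have v0: "lin f v 0 \<noteq> 0"
    proof
      assume v0: "lin f v 0 = 0"
      then have "(\<Sum>i\<in>{1..<d}. lin f v i * lin f v i) = 0"
        using Q(1) sum_nonneg[of "{1..<d}" "\<lambda>i. lin f v i * lin f v i"] by (simp add: inner_def)
      then have "\<forall>i\<in>{1..<d}. lin f v i = 0"
        by (subst (asm) sum_nonneg_eq_0_iff) auto
      then have "lin f v i = 0" if "i < d" for i
        using v0 that by (cases i) auto
      then have "lin f v = (\<lambda>_. 0)"
        by (intro V_eqI lin_V[OF iso] V_zero)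
      then show False
        using lin_eq_0_iff[OF dec_Obs[OF k] \<open>v \<in> V\<close>] \<open>v \<noteq> (\<lambda>_. 0)\<close> by blast
    qed
    \<comment> \<open>The factor that rescales the difference \<open>v\<close> to mass
      \<open>m\<close>; the half-line is unchanged and reaches \<open>Y\<close> at parameter
      \<open>1 / s\<close>.\<close>
    define s where "s = m / \<bar>lin f v 0\<bar>"
    have "0 < s"
      using m v0 by (simp add: s_def)
    have "v \<in> Momenta ftl"
      using \<open>v \<in> V\<close> \<open>v \<noteq> (\<lambda>_. 0)\<close> Q(2) by (simp add: Momenta_def)
    then obtain b where b: "dec b = Part X (\<lambda>i. s * v i)"
      using exists_Part[OF X(1) Momenta_scale] \<open>0 < s\<close> by (metis less_irrefl)
    have "\<bar>lin f (\<lambda>i. s * v i) 0\<bar> = m"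
      unfolding lin_scale[OF iso] using v0 m by (simp add: abs_mult s_def)
    moreover have "(\<lambda>i. X i + 1 / s * (s * v i)) \<in> trace (dec b)"
      unfolding b using \<open>0 < s\<close> by (intro trace_Part) simp
    then have "Y \<in> trace (dec b)"
      using \<open>0 < s\<close> by (simp add: v_def del: trace.simps)
    ultimately show ?thesis
      using b by blast
  qed
  then obtain b p where b: "dec b = Part X p" "\<bar>lin f p 0\<bar> = m" "Y \<in> trace (dec b)"
    by blast
  have "X \<in> trace (dec b)"
    unfolding b(1) by (rule trace_Part order_refl)+
  then show "\<exists>b\<in>bodies Mod. Ip d Mod b \<and> Wrel Mod k b xs \<and> Wrel Mod k b ys \<and> mass Mod k b = Some m"
    using Wrel_iff[OF k len(1) X] Wrel_iff[OF k len(2) Y] Ip_iff b mass_Part[OF k b(1)]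
    by (intro bexI[of _ b]) simp_all
qed

lemma SRDyn_Mod: "\<psi> \<in> SRDyn d \<Longrightarrow> \<psi> Mod"
  unfolding SRDyn_def SR_def Coll_def SPRplus_def
  using SPRplus_Mod AxLight_Mod AxEField_real[OF real_quants_Mod] AxEv_Mod AxSelf_Mod AxSymD_Mod
    AxColl_Mod AxAllInecoll_Mod AxSpd_Mod AxMass_Mod AxThExPlus_Mod AxAllColl_Mod
  by blast

section \<open>Faster than light particles and independence\<close>

text \<open>Two events on the half-line differ by a multiple of \<open>lin f p\<close>, whose
  \<open>Q\<close> equals \<open>Q p\<close>; being faster than light is therefore the same for all
  observers.\<close>

lemma FTL_Part_iff:
  assumes k: "dec k = Obs f" and b: "dec b = Part x p"
  shows "FTL d Mod k b \<longleftrightarrow> Q p < 0"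
proof -
  define pt where "pt t = of_coords (\<lambda>i. f x i + t * lin f p i)" for t
  have W: "Wrel Mod k b xs \<longleftrightarrow> (\<exists>t\<ge>0. xs = pt t)" for xs
    unfolding pt_def by (rule Wrel_Part[OF k b])
  have "Q (\<lambda>i. coords (pt s) i - coords (pt t) i) = (s - t)\<^sup>2 * Q p" for s t
  proof -
    have "Q (\<lambda>i. coords (pt s) i - coords (pt t) i) = Q (\<lambda>i. (s - t) * proj (lin f p) i)"
      by (intro arg_cong2[of _ _ _ _ inner] ext) (simp_all add: pt_def proj_def algebra_simps)
    then show ?thesis
      by (simp add: Q_scale isometryD(4) poincare_isometry[OF dec_Obs[OF k]])
  qed
  then have lt: "lessQ Mod (time_dist Mod (pt s) (pt t)) (space_dist d Mod (pt s) (pt t)) \<longleftrightarrow>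
      (s - t)\<^sup>2 * Q p < 0" for s t
    by (simp add: Mod_real(6) time_space_Mod del: real_sqrt_abs)
  have "FTL d Mod k b \<longleftrightarrow> (\<exists>s\<ge>0. \<exists>t\<ge>0. (s - t)\<^sup>2 * Q p < 0)"
  proof
    assume "FTL d Mod k b"
    then obtain s t where "0 \<le> s" "0 \<le> t"
      "lessQ Mod (time_dist Mod (pt s) (pt t)) (space_dist d Mod (pt s) (pt t))"
      unfolding FTL_def W by blast
    then show "\<exists>s\<ge>0. \<exists>t\<ge>0. (s - t)\<^sup>2 * Q p < 0"
      unfolding lt by blast
  next
    assume "\<exists>s\<ge>0. \<exists>t\<ge>0. (s - t)\<^sup>2 * Q p < 0"
    then obtain s t where st: "0 \<le> s" "0 \<le> t" "(s - t)\<^sup>2 * Q p < 0"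
      by blast
    have "k \<in> IOb Mod" "pt s \<in> points d Mod" "pt t \<in> points d Mod"
      using k by (simp_all add: pt_def)
    then show "FTL d Mod k b"
      unfolding FTL_def W using st lt[of s t] by blast
  qed
  also have "\<dots> \<longleftrightarrow> Q p < 0"
  proof
    assume "Q p < 0"
    then have "(1 - 0)\<^sup>2 * Q p < 0"
      by simp
    then show "\<exists>s\<ge>0. \<exists>t\<ge>0. (s - t)\<^sup>2 * Q p < 0"
      using zero_le_one order_refl by blast
  qed (auto simp: mult_less_0_iff)
  finally show ?thesis .
qed

lemma ExFTLIp_Mod_iff: "ExFTLIp d Mod \<longleftrightarrow> ftl"
proof
  assume "ExFTLIp d Mod"
  then obtain k b where kb: "Ip d Mod b" "FTL d Mod k b"
    by (auto simp: ExFTLIp_def)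
  then obtain f x p where k: "dec k = Obs f" and b: "dec b = Part x p"
    using Ip_iff by (auto simp: FTL_def)
  show ftl
    using kb(2) FTL_Part_iff[OF k b] dec_Part(2)[OF b] by (auto simp: Momenta_def)
next
  assume ftl
  \<comment> \<open>A spacelike vector, with \<open>Q p = 1 - 4\<close>, whose time component 1
    becomes a positive mass for the observer \<open>proj\<close>.\<close>
  define p :: vec where "p = (\<lambda>i. if i = 0 then 1 else if i = 1 then 2 else 0)"
  have "(\<Sum>i\<in>{1..<d}. p i * p i) = (\<Sum>i\<in>{1..<2}. p i * p i)"
    using dim by (intro sum.mono_neutral_right) (auto simp: p_def)
  then have Q: "Q p < 0"
    by (simp add: inner_def p_def numeral_2_eq_2)
  have "p \<in> V"
    using dim by (simp add: V_def p_def)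
  moreover have "p \<noteq> (\<lambda>_. 0)"
    by (auto simp: p_def fun_eq_iff intro: exI[of _ 0])
  ultimately have "p \<in> Momenta ftl"
    using \<open>ftl\<close> by (simp add: Momenta_def)
  then obtain b where b: "dec b = Part (\<lambda>_. 0) p"
    using exists_Part[OF V_zero] by blast
  obtain k where k: "dec k = Obs proj"
    using exists_Obs[OF proj_poincare] by blast
  have "mass Mod k b = Some 1"
    unfolding mass_Part[OF k b] by (simp add: lin_proj proj_def p_def)
  then show "ExFTLIp d Mod"
    unfolding ExFTLIp_def using Ip_iff b FTL_Part_iff[OF k b] Q
    by (intro bexI[of _ k] bexI[of _ b]) (simp_all add: Mod_real(4,6))
qed

end

lemma exists_SRDyn_model:
  assumes "2 \<le> d"
  shows "\<exists>M :: (real, real) model. is_model d M \<and> (\<forall>\<psi>\<in>SRDyn d. \<psi> M) \<and> (ExFTLIp d M \<longleftrightarrow> ftl)"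
proof -
  interpret minkowski d
    by standard (rule assms)
  obtain dec :: "real \<Rightarrow> body" where "bij_betw dec UNIV (Bodies ftl)"
    using exists_bij_Bodies by blast
  then interpret srdyn_model d ftl dec
    by unfold_locales
  show ?thesis
    using is_model_Mod SRDyn_Mod ExFTLIp_Mod_iff by blast
qed

theorem theorem7p1:
  fixes d :: nat
  assumes "2 \<le> d"
  shows "independent_of d (ExFTLIp d :: (real, real) sentence) (SRDyn d)"
  using exists_SRDyn_model[OF assms, of True] exists_SRDyn_model[OF assms, of False]
  unfolding independent_of_def entails_def NotS_def by blast

end
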